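(* Let $(X,A)$ be an almost Euclidean compact pair, where $X$ is an ANR. If every regular cell $C\subseteq X\setminus A$ belongs to a relative cycle, then $(X,A)$ has the $\epsilon$-surjection property for some $\epsilon>0$.
   Context: A compact pair $(X,A)$ consists of a compact metrizable space $X$ and a compact subset $A\subseteq X$. A compact metrizable space is an absolute neighborhood retract (ANR) if every (equivalently, some) homeomorphic copy of it in the Hilbert cube $Q=[0,1]^{\mathbb{N}}$ is a retract of an open subset of $Q$ containing it. A point $x$ of a space is $n$-Euclidean ($n\geq1$) if it has an open neighborhood homeomorphic to $\mathbb{R}^n$, and Euclidean if it is $n$-Euclidean for some $n\ge1$. A space is almost Euclidean if its Euclidean points are dense. A pair $(X,A)$ is almost Euclidean if $X\setminus A$ is almost Euclidean. Let $\mathbb{B}_n$ be the closed unit ball of $\mathbb{R}^n$ and $\mathbb{S}_{n-1}$ its boundary sphere. For $n\geq1$, a set $C\subseteq X$ is a regular $n$-cell if there is a homeomorphism $f:\mathbb{B}_n\to C$ such that $f(\mathbb{B}_n\setminus\mathbb{S}_{n-1})$ is open in $X$; then $\mathrm{op}(C)=f(\mathbb{B}_n\setminus\mathbb{S}_{n-1})$ is the corresponding open cell. A regular cell is a regular $n$-cell for some $n\ge1$. Let $\mathbb{T}=\mathbb{R}/\mathbb{Z}$. A regular $n$-cell $C\subseteq X\setminus A$ belongs to a relative cycle if the canonical homomorphism $H_n(X,A;\mathbb{T})\to H_n(X,X\setminus\mathrm{op}(C);\mathbb{T})$ (singular homology) is non-trivial. Fix a compatible metric $d$ on $X$. $(X,A)$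 has the $\epsilon$-surjection property if every continuous $f:X\to X$ with $f|_A=\mathrm{id}_A$ and $d(f(x),x)<\epsilon$ for all $x\in X$ is surjective. (Whether this holds for some $\epsilon>0$ is independent of the choice of compatible metric.) *)

theory Defs
  imports "HOL-Analysis.Analysis" "HOL-Homology.Homology"
begin

section \<open>The coefficient group $\mathbb{R}/\mathbb{Z}$\<close>

quotient_type circle_group = real / "\<lambda>x y :: real. x - y \<in> \<int>"
proof (rule equivpI)
  show "reflp (\<lambda>x y :: real. x - y \<in> \<int>)"
    by (simp add: reflp_def)
  show "symp (\<lambda>x y :: real. x - y \<in> \<int>)"
  proof (rule sympI)
    fix x y :: real
    assume "x - y \<in> \<int>"
    then have "- (x - y) \<in> \<int>"
      by (rule Ints_minus)
    then show "y - x \<in> \<int>"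
      by simp
  qed
  show "transp (\<lambda>x y :: real. x - y \<in> \<int>)"
  proof (rule transpI)
    fix x y z :: real
    assume "x - y \<in> \<int>" "y - z \<in> \<int>"
    then have "(x - y) + (y - z) \<in> \<int>"
      by (rule Ints_add)
    then show "x - z \<in> \<int>"
      by simp
  qed
qed

instantiation circle_group :: ab_group_add
begin

lift_definition zero_circle_group :: circle_group is "0 :: real" .

lift_definition plus_circle_group :: "circle_group \<Rightarrow> circle_group \<Rightarrow> circle_group"
  is "(+) :: real \<Rightarrow> real \<Rightarrow> real"
proof -
  fix a b c d :: real
  assume "a - b \<in> \<int>" "c - d \<in> \<int>"
  then have "(a - b) + (c - d) \<in> \<int>"
    by (rule Ints_add)
  then show "a + c - (b + d) \<in> \<int>"
    by (simp add: algebra_simps)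
qed

lift_definition uminus_circle_group :: "circle_group \<Rightarrow> circle_group"
  is "uminus :: real \<Rightarrow> real"
proof -
  fix a b :: real
  assume "a - b \<in> \<int>"
  then have "- (a - b) \<in> \<int>"
    by (rule Ints_minus)
  then show "- a - - b \<in> \<int>"
    by simp
qed

lift_definition minus_circle_group :: "circle_group \<Rightarrow> circle_group \<Rightarrow> circle_group"
  is "(-) :: real \<Rightarrow> real \<Rightarrow> real"
proof -
  fix a b c d :: real
  assume "a - b \<in> \<int>" "c - d \<in> \<int>"
  then have "(a - b) - (c - d) \<in> \<int>"
    by (rule Ints_diff)
  then show "a - c - (b - d) \<in> \<int>"
    by (simp add: algebra_simps)
qed

instance
proof
  fix a b c :: circle_group
  show "a + b + c = a + (b + c)"
    by transfer (simp add: add.assoc)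
  show "a + b = b + a"
    by transfer (simp add: add.commute)
  show "0 + a = a"
    by transfer simp
  show "- a + a = 0"
    by transfer simp
  show "a - b = a + - b"
    by transfer simp
qed

end


section \<open>Singular homology with coefficients\<close>

text \<open>The library's singular homology has integer coefficients only.  The development below is
  parallel to it, with coefficients in an arbitrary abelian group and with the library's singular
  simplices and faces.  As there, $H_p(X,S)$ is the quotient of the group of chains of $X$ with
  boundary in $S$ by the group of chains of the form $\partial d + e$ with $d$ a chain of $X$ and
  $e$ a chain of $S$.\<close>

type_synonym ('a, 'g) coeff_chain = "((nat \<Rightarrow> real) \<Rightarrow> 'a) \<Rightarrow>\<^sub>0 'g"

definition coeff_singular_chain ::
    "nat \<Rightarrow> 'a topology \<Rightarrow> ('a, 'g::ab_group_add) coeff_chain \<Rightarrow> bool"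
  where "coeff_singular_chain p X c \<longleftrightarrow> Poly_Mapping.keys c \<subseteq> singular_simplex_set p X"

definition coeff_boundary ::
    "nat \<Rightarrow> ('a, 'g::ab_group_add) coeff_chain \<Rightarrow> ('a, 'g) coeff_chain"
  where "coeff_boundary p c =
    (if p = 0 then 0
     else \<Sum>s\<in>Poly_Mapping.keys c. \<Sum>k\<le>p.
       Poly_Mapping.single (singular_face p k s)
         (if even k then Poly_Mapping.lookup c s else - Poly_Mapping.lookup c s))"

definition coeff_relcycle ::
    "nat \<Rightarrow> 'a topology \<Rightarrow> 'a set \<Rightarrow> ('a, 'g::ab_group_add) coeff_chain \<Rightarrow> bool"
  where "coeff_relcycle p X S c \<longleftrightarrow>
    coeff_singular_chain p X c \<and>
    coeff_singular_chain (p - 1) (subtopology X S) (coeff_boundary p c)"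

definition coeff_relboundary ::
    "nat \<Rightarrow> 'a topology \<Rightarrow> 'a set \<Rightarrow> ('a, 'g::ab_group_add) coeff_chain \<Rightarrow> bool"
  where "coeff_relboundary p X S c \<longleftrightarrow>
    (\<exists>d e. coeff_singular_chain (Suc p) X d \<and> coeff_singular_chain p (subtopology X S) e \<and>
           c = coeff_boundary (Suc p) d + e)"

definition coeff_relcycle_group ::
    "nat \<Rightarrow> 'a topology \<Rightarrow> 'a set \<Rightarrow> ('a, 'g::ab_group_add) coeff_chain monoid"
  where "coeff_relcycle_group p X S =
    \<lparr>carrier = Collect (coeff_relcycle p X S), mult = (+), one = 0\<rparr>"

definition coeff_homology_group ::
    "nat \<Rightarrow> 'a topology \<Rightarrow> 'a set \<Rightarrow> ('a, 'g::ab_group_add) coeff_chain set monoid"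
  where "coeff_homology_group p X S =
    coeff_relcycle_group p X S Mod Collect (coeff_relboundary p X S)"

text \<open>The homomorphism $H_p(X,S) \to H_p(X,T)$ induced by the inclusion, for $S \subseteq T$.
  It sends the coset of a cycle $c$ modulo the boundaries of $(X,S)$ to its coset modulo the
  boundaries of $(X,T)$; see \<open>coeff_inclusion_hom_class\<close> and \<open>coeff_inclusion_hom_hom\<close> below.\<close>

definition coeff_inclusion_hom ::
    "nat \<Rightarrow> 'a topology \<Rightarrow> 'a set \<Rightarrow>
     ('a, 'g::ab_group_add) coeff_chain set \<Rightarrow> ('a, 'g) coeff_chain set"
  where "coeff_inclusion_hom p X T K =
    Collect (coeff_relboundary p X T) <#>\<^bsub>coeff_relcycle_group p X T\<^esub> K"


subsection \<open>These are abelian groups and homomorphisms\<close>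

lemma coeff_singular_chain_0 [simp]: "coeff_singular_chain p X 0"
  by (simp add: coeff_singular_chain_def)

lemma coeff_singular_chain_minus [simp]:
  "coeff_singular_chain p X (- c) \<longleftrightarrow> coeff_singular_chain p X c"
  by (simp add: coeff_singular_chain_def)

lemma coeff_singular_chain_add:
  "coeff_singular_chain p X a \<Longrightarrow> coeff_singular_chain p X b \<Longrightarrow> coeff_singular_chain p X (a + b)"
  unfolding coeff_singular_chain_def using keys_add [of a b] by blast

lemma coeff_singular_chain_sum:
  "(\<And>i. i \<in> I \<Longrightarrow> coeff_singular_chain p X (f i)) \<Longrightarrow> coeff_singular_chain p X (sum f I)"
  by (induction I rule: infinite_finite_induct) (auto intro: coeff_singular_chain_add)

lemma coeff_singular_chain_single:
  "singular_simplex p X s \<Longrightarrow> coeff_singular_chain p X (Poly_Mapping.single s g)"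
  by (simp add: coeff_singular_chain_def)

lemma coeff_singular_chain_mono:
  assumes "S \<subseteq> T" "coeff_singular_chain p (subtopology X S) c"
  shows "coeff_singular_chain p (subtopology X T) c"
  using assms singular_simplex_mono unfolding coeff_singular_chain_def by blast

lemma coeff_singular_chain_subtopologyD:
  "coeff_singular_chain p (subtopology X S) c \<Longrightarrow> coeff_singular_chain p X c"
  unfolding coeff_singular_chain_def by (auto simp: singular_simplex_subtopology)

lemma coeff_boundary_superset:
  assumes "finite I" "Poly_Mapping.keys c \<subseteq> I" "p \<noteq> 0"
  shows "coeff_boundary p c = (\<Sum>s\<in>I. \<Sum>k\<le>p.
       Poly_Mapping.single (singular_face p k s)
         (if even k then Poly_Mapping.lookup c s else - Poly_Mapping.lookup c s))"
    (is "_ = sum ?h I")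
proof -
  have "sum ?h (Poly_Mapping.keys c) = sum ?h I"
  proof (rule sum.mono_neutral_left [OF assms(1,2)], rule ballI)
    fix s assume "s \<in> I - Poly_Mapping.keys c"
    then have "Poly_Mapping.lookup c s = 0"
      by (simp add: in_keys_iff)
    then show "?h s = 0"
      by (simp cong: if_cong)
  qed
  then show ?thesis
    using assms(3) by (simp add: coeff_boundary_def)
qed

lemma coeff_boundary_0 [simp]: "coeff_boundary p 0 = 0"
  by (simp add: coeff_boundary_def)

lemma coeff_boundary_add:
  "coeff_boundary p (a + b) = coeff_boundary p a + coeff_boundary p b"
proof (cases "p = 0")
  case False
  let ?I = "Poly_Mapping.keys a \<union> Poly_Mapping.keys b"
  have 1: "finite ?I" "Poly_Mapping.keys a \<subseteq> ?I" "Poly_Mapping.keys b \<subseteq> ?I"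
    "Poly_Mapping.keys (a + b) \<subseteq> ?I"
    using keys_add [of a b] by auto
  show ?thesis
    unfolding coeff_boundary_superset [OF 1(1) 1(2) False]
      coeff_boundary_superset [OF 1(1) 1(3) False] coeff_boundary_superset [OF 1(1) 1(4) False]
      sum.distrib [symmetric]
    by (intro sum.cong refl) (simp add: lookup_add single_add [symmetric])
qed (simp add: coeff_boundary_def)

lemma coeff_boundary_minus:
  "coeff_boundary p (- a) = - coeff_boundary p a"
  using coeff_boundary_add [of p a "- a"] by (simp add: eq_neg_iff_add_eq_0 add.commute)

lemma coeff_boundary_sum:
  "coeff_boundary p (sum f I) = (\<Sum>i\<in>I. coeff_boundary p (f i))"
  by (induction I rule: infinite_finite_induct) (auto simp: coeff_boundary_add)

lemma coeff_boundary_single: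
  "coeff_boundary p (Poly_Mapping.single s g) =
    (if p = 0 then 0 else \<Sum>k\<le>p. Poly_Mapping.single (singular_face p k s) (if even k then g else - g))"
proof (cases "p = 0")
  case False
  have "Poly_Mapping.keys (Poly_Mapping.single s g) \<subseteq> {s}"
    by simp
  then show ?thesis
    using False by (subst coeff_boundary_superset [where I = "{s}"]) (simp_all add: lookup_single cong: if_cong)
qed (simp add: coeff_boundary_def)

lemma coeff_singular_chain_boundary:
  assumes "coeff_singular_chain p X c"
  shows "coeff_singular_chain (p - 1) X (coeff_boundary p c)"
proof (cases "p = 0")
  case False
  have "singular_simplex (p - Suc 0) X (singular_face p k s)"
    if "s \<in> Poly_Mapping.keys c" "k \<le> p" for s k
    using assms that False
    by (intro singular_simplex_singular_face) (auto simp: coeff_singular_chain_def)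
  then show ?thesis
    using False
    by (simp only: coeff_boundary_def if_False One_nat_def)
       (intro coeff_singular_chain_sum coeff_singular_chain_single, simp)
qed (simp add: coeff_boundary_def)

lemma singular_face_singular_face:
  assumes "i \<le> j" "j \<le> Suc p"
  shows "singular_face (Suc p) i (singular_face (Suc (Suc p)) (Suc j) s) =
         singular_face (Suc p) j (singular_face (Suc (Suc p)) i s)"
proof
  fix t
  show "singular_face (Suc p) i (singular_face (Suc (Suc p)) (Suc j) s) t =
        singular_face (Suc p) j (singular_face (Suc (Suc p)) i s) t"
  proof (cases "t \<in> standard_simplex p")
    case True
    have "simplical_face i t \<in> standard_simplex (Suc p)"
         "simplical_face j t \<in> standard_simplex (Suc p)"
      using assms True by (auto intro!: simplical_face_in_standard_simplex)
    moreover have "simplical_face (Suc j) (simplical_face i t) = simplical_face i (simplical_face j t)"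
      using assms(1) unfolding simplical_face_def by fastforce
    ultimately show ?thesis
      using True by (simp add: singular_face_def)
  qed (simp add: singular_face_def)
qed

lemma coeff_boundary_boundary_single:
  "coeff_boundary (Suc p) (coeff_boundary (Suc (Suc p)) (Poly_Mapping.single s g)) = 0"
proof -
  let ?F = "\<lambda>(k, j). Poly_Mapping.single (singular_face (Suc p) j (singular_face (Suc (Suc p)) k s))
              (if even (k + j) then g else - g)"
  let ?U = "{..Suc (Suc p)} \<times> {..Suc p}"
  let ?L = "{(k, j) \<in> ?U. j < k}" and ?G = "{(k, j) \<in> ?U. k \<le> j}"
  have "coeff_boundary (Suc p) (coeff_boundary (Suc (Suc p)) (Poly_Mapping.single s g)) = sum ?F ?U"
    unfolding sum.cartesian_product [symmetric]
    by (simp only: coeff_boundary_single coeff_boundary_sum nat.simps if_False)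
       (intro sum.cong refl, simp)
  also have "\<dots> = sum ?F ?L + sum ?F ?G"
  proof (subst sum.union_disjoint [symmetric])
    show "finite ?L" "finite ?G"
      by (rule finite_subset [where B = ?U]; auto)+
  qed (auto intro!: sum.cong)
  also have "sum ?F ?L = (\<Sum>x\<in>?G. - ?F x)"
  proof (rule sum.reindex_bij_witness [where i = "\<lambda>(k, j). (Suc j, k)" and j = "\<lambda>(k, j). (j, k - 1)"])
    fix x assume "x \<in> ?L"
    then obtain k' j where x: "x = (Suc k', j)" "j \<le> k'" "k' \<le> Suc p"
      by (cases x; case_tac "fst x") auto
    then show "- ?F (case x of (k, j) \<Rightarrow> (j, k - 1)) = ?F x"
      using singular_face_singular_face [of j k' p s]
      by (auto simp: single_uminus [symmetric] add.commute)
  qed auto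
  finally show ?thesis
    by (simp add: sum_negf)
qed

lemma poly_mapping_sum_single:
  "c = (\<Sum>s\<in>Poly_Mapping.keys c. Poly_Mapping.single s (Poly_Mapping.lookup c s))"
proof (rule poly_mapping_eqI)
  fix x
  show "Poly_Mapping.lookup c x =
    Poly_Mapping.lookup (\<Sum>s\<in>Poly_Mapping.keys c. Poly_Mapping.single s (Poly_Mapping.lookup c s)) x"
    by (auto simp: lookup_sum lookup_single when_def in_keys_iff if_distrib cong: if_cong)
qed

lemma coeff_boundary_boundary: "coeff_boundary p (coeff_boundary (Suc p) c) = 0"
proof (cases p)
  case (Suc q)
  show ?thesis
    unfolding Suc
    by (subst poly_mapping_sum_single [of c])
       (simp add: coeff_boundary_sum coeff_boundary_boundary_single)
qed (simp add: coeff_boundary_def)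

lemma coeff_relcycle_0 [simp]: "coeff_relcycle p X S 0"
  by (simp add: coeff_relcycle_def)

lemma coeff_relcycle_minus: "coeff_relcycle p X S c \<Longrightarrow> coeff_relcycle p X S (- c)"
  by (simp add: coeff_relcycle_def coeff_boundary_minus)

lemma coeff_relcycle_add:
  "coeff_relcycle p X S a \<Longrightarrow> coeff_relcycle p X S b \<Longrightarrow> coeff_relcycle p X S (a + b)"
  by (simp add: coeff_relcycle_def coeff_boundary_add coeff_singular_chain_add)

lemma coeff_relcycle_mono:
  "S \<subseteq> T \<Longrightarrow> coeff_relcycle p X S c \<Longrightarrow> coeff_relcycle p X T c"
  by (auto simp: coeff_relcycle_def intro: coeff_singular_chain_mono)

lemma coeff_relboundary_mono:
  "S \<subseteq> T \<Longrightarrow> coeff_relboundary p X S c \<Longrightarrow> coeff_relboundary p X T c"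
  unfolding coeff_relboundary_def using coeff_singular_chain_mono by blast

lemma coeff_relboundary_0 [simp]: "coeff_relboundary p X S 0"
  unfolding coeff_relboundary_def by (rule exI [of _ 0])+ simp

lemma coeff_relboundary_minus:
  assumes "coeff_relboundary p X S c"
  shows "coeff_relboundary p X S (- c)"
proof -
  obtain d e where "coeff_singular_chain (Suc p) X d" "coeff_singular_chain p (subtopology X S) e"
      "c = coeff_boundary (Suc p) d + e"
    using assms unfolding coeff_relboundary_def by blast
  then show ?thesis
    unfolding coeff_relboundary_def
    by (intro exI [of _ "- d"] exI [of _ "- e"]) (simp add: coeff_boundary_minus)
qed

lemma coeff_relboundary_add:
  assumes "coeff_relboundary p X S a" "coeff_relboundary p X S b"
  shows "coeff_relboundary p X S (a + b)"
proof -
  obtain d e where "coeff_singular_chain (Suc p) X d" "coeff_singular_chain p (subtopology X S) e"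
      "a = coeff_boundary (Suc p) d + e"
    using assms(1) unfolding coeff_relboundary_def by blast
  moreover obtain d' e' where "coeff_singular_chain (Suc p) X d'"
      "coeff_singular_chain p (subtopology X S) e'" "b = coeff_boundary (Suc p) d' + e'"
    using assms(2) unfolding coeff_relboundary_def by blast
  ultimately show ?thesis
    unfolding coeff_relboundary_def
    by (intro exI [of _ "d + d'"] exI [of _ "e + e'"])
       (simp add: coeff_boundary_add coeff_singular_chain_add algebra_simps)
qed

lemma coeff_relboundary_imp_relcycle:
  assumes "coeff_relboundary p X S c"
  shows "coeff_relcycle p X S c"
proof -
  obtain d e where d: "coeff_singular_chain (Suc p) X d"
      and e: "coeff_singular_chain p (subtopology X S) e"
      and c: "c = coeff_boundary (Suc p) d + e"
    using assms unfolding coeff_relboundary_def by blast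
  show ?thesis
    using coeff_singular_chain_boundary [OF d] coeff_singular_chain_boundary [OF e]
      coeff_singular_chain_subtopologyD [OF e]
    by (simp add: coeff_relcycle_def c coeff_boundary_add coeff_boundary_boundary
        coeff_singular_chain_add)
qed

lemma comm_group_coeff_relcycle_group: 
  "comm_group (coeff_relcycle_group p X S :: ('a, 'b::ab_group_add) coeff_chain monoid)"
proof (rule comm_groupI)
  fix x :: "('a, 'b) coeff_chain"
  assume "x \<in> carrier (coeff_relcycle_group p X S)"
  then show "\<exists>y\<in>carrier (coeff_relcycle_group p X S).
      y \<otimes>\<^bsub>coeff_relcycle_group p X S\<^esub> x = \<one>\<^bsub>coeff_relcycle_group p X S\<^esub>"
    by (intro bexI [of _ "- x"]) (auto simp: coeff_relcycle_group_def coeff_relcycle_minus)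
qed (auto simp: coeff_relcycle_group_def coeff_relcycle_add algebra_simps)

lemma inv_coeff_relcycle_group:
  assumes "coeff_relcycle p X S c"
  shows "inv\<^bsub>coeff_relcycle_group p X S\<^esub> c = - c"
  by (rule group.inv_equality [OF comm_group.axioms(2) [OF comm_group_coeff_relcycle_group]])
     (use assms in \<open>auto simp: coeff_relcycle_group_def coeff_relcycle_minus\<close>)

lemma normal_coeff_relboundary:
  "Collect (coeff_relboundary p X S) \<lhd>
    (coeff_relcycle_group p X S :: ('a, 'b::ab_group_add) coeff_chain monoid)"
proof -
  interpret comm_group "coeff_relcycle_group p X S :: ('a, 'b) coeff_chain monoid"
    by (rule comm_group_coeff_relcycle_group)
  have "subgroup (Collect (coeff_relboundary p X S))
          (coeff_relcycle_group p X S :: ('a, 'b) coeff_chain monoid)"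
  proof (rule subgroup.intro)
    fix x :: "('a, 'b) coeff_chain"
    assume "x \<in> Collect (coeff_relboundary p X S)"
    then show "inv\<^bsub>coeff_relcycle_group p X S\<^esub> x \<in> Collect (coeff_relboundary p X S)"
      by (simp add: inv_coeff_relcycle_group coeff_relboundary_imp_relcycle coeff_relboundary_minus)
  qed (auto simp: coeff_relcycle_group_def coeff_relboundary_imp_relcycle coeff_relboundary_add)
  then show ?thesis
    by (simp add: normal_iff_subgroup)
qed

lemma group_coeff_homology_group: "group (coeff_homology_group p X S)"
  unfolding coeff_homology_group_def
  by (rule normal.factorgroup_is_group [OF normal_coeff_relboundary])

lemma carrier_coeff_homology_group:
  "carrier (coeff_homology_group p X S) =
   (\<lambda>c. Collect (coeff_relboundary p X S) #>\<^bsub>coeff_relcycle_group p X S\<^esub> c) `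
     Collect (coeff_relcycle p X S)"
  by (auto simp: coeff_homology_group_def FactGroup_def RCOSETS_def coeff_relcycle_group_def)

lemma coeff_inclusion_hom_class:
  assumes "S \<subseteq> T"
  shows "coeff_inclusion_hom p X T
           (Collect (coeff_relboundary p X S) #>\<^bsub>coeff_relcycle_group p X S\<^esub> c) =
         Collect (coeff_relboundary p X T) #>\<^bsub>coeff_relcycle_group p X T\<^esub> c"
proof -
  have 1: "Collect (coeff_relboundary p X U) #>\<^bsub>coeff_relcycle_group p X U\<^esub> c =
      {h + c |h. coeff_relboundary p X U h}" for U
    by (auto simp: r_coset_def coeff_relcycle_group_def)
  have "coeff_inclusion_hom p X T {h + c |h. coeff_relboundary p X S h} =
      {a + (b + c) |a b. coeff_relboundary p X T a \<and> coeff_relboundary p X S b}"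
    by (auto simp: coeff_inclusion_hom_def set_mult_def coeff_relcycle_group_def)
  also have "\<dots> = {h + c |h. coeff_relboundary p X T h}"
  proof (intro subset_antisym subsetI)
    fix x assume "x \<in> {a + (b + c) |a b. coeff_relboundary p X T a \<and> coeff_relboundary p X S b}"
    then obtain a b where a: "coeff_relboundary p X T a" and b: "coeff_relboundary p X S b"
        and x: "x = (a + b) + c"
      by (auto simp: add.assoc)
    have "coeff_relboundary p X T (a + b)"
      by (rule coeff_relboundary_add [OF a coeff_relboundary_mono [OF assms b]])
    then show "x \<in> {h + c |h. coeff_relboundary p X T h}"
      unfolding x by blast
  next
    fix x assume "x \<in> {h + c |h. coeff_relboundary p X T h}"
    then obtain h where h: "coeff_relboundary p X T h" and x: "x = h + (0 + c)"
      by auto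
    then show "x \<in> {a + (b + c) |a b. coeff_relboundary p X T a \<and> coeff_relboundary p X S b}"
      using coeff_relboundary_0 by blast
  qed
  finally show ?thesis
    unfolding 1 .
qed

lemma coeff_inclusion_hom_hom:
  assumes "S \<subseteq> T"
  shows "coeff_inclusion_hom p X T \<in>
    hom (coeff_homology_group p X S :: ('a, 'b::ab_group_add) coeff_chain set monoid)
        (coeff_homology_group p X T)"
proof (rule homI)
  fix x :: "('a, 'b) coeff_chain set"
  assume "x \<in> carrier (coeff_homology_group p X S)"
  then obtain a where a: "coeff_relcycle p X S a"
      and x: "x = Collect (coeff_relboundary p X S) #>\<^bsub>coeff_relcycle_group p X S\<^esub> a"
    unfolding carrier_coeff_homology_group by blast
  show "coeff_inclusion_hom p X T x \<in> carrier (coeff_homology_group p X T)"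
    unfolding x coeff_inclusion_hom_class [OF assms] carrier_coeff_homology_group
    using coeff_relcycle_mono [OF assms a] by blast
next
  have *: "coeff_relcycle p X U a \<Longrightarrow> coeff_relcycle p X U b \<Longrightarrow>
      (Collect (coeff_relboundary p X U) #>\<^bsub>coeff_relcycle_group p X U\<^esub> a)
        \<otimes>\<^bsub>coeff_homology_group p X U\<^esub>
      (Collect (coeff_relboundary p X U) #>\<^bsub>coeff_relcycle_group p X U\<^esub> b) =
      Collect (coeff_relboundary p X U) #>\<^bsub>coeff_relcycle_group p X U\<^esub> (a + b)"
    for U and a b :: "('a, 'b) coeff_chain"
    using normal.rcos_sum [OF normal_coeff_relboundary [of p X U], of a b]
    by (simp add: coeff_homology_group_def) (simp add: coeff_relcycle_group_def)
  fix x y :: "('a, 'b) coeff_chain set"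
  assume "x \<in> carrier (coeff_homology_group p X S)" "y \<in> carrier (coeff_homology_group p X S)"
  then obtain a b where a: "coeff_relcycle p X S a" and b: "coeff_relcycle p X S b"
      and x: "x = Collect (coeff_relboundary p X S) #>\<^bsub>coeff_relcycle_group p X S\<^esub> a"
      and y: "y = Collect (coeff_relboundary p X S) #>\<^bsub>coeff_relcycle_group p X S\<^esub> b"
    unfolding carrier_coeff_homology_group by blast
  show "coeff_inclusion_hom p X T (x \<otimes>\<^bsub>coeff_homology_group p X S\<^esub> y) =
    coeff_inclusion_hom p X T x \<otimes>\<^bsub>coeff_homology_group p X T\<^esub> coeff_inclusion_hom p X T y"
    unfolding x y * [OF a b] coeff_inclusion_hom_class [OF assms]
    using * [OF coeff_relcycle_mono [OF assms a] coeff_relcycle_mono [OF assms b]] by simp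
qed


section \<open>Compact pairs and absolute neighborhood retracts\<close>

definition compact_pair :: "'a topology \<Rightarrow> 'a set \<Rightarrow> bool"
  where "compact_pair X A \<longleftrightarrow> compact_space X \<and> metrizable_space X \<and> compactin X A"

definition Hilbert_cube :: "(nat \<Rightarrow> real) topology"
  where "Hilbert_cube = product_topology (\<lambda>_. subtopology euclideanreal {0..1}) UNIV"

text \<open>The library's \<^const>\<open>ANR\<close> only quantifies over copies of the space inside a type determined by
  the type of its points, which is not adequate for spaces of infinite dimension.\<close>

definition compact_ANR :: "'a topology \<Rightarrow> bool"
  where "compact_ANR X \<longleftrightarrow>
    compact_space X \<and> metrizable_space X \<and>
    (\<forall>S. S \<subseteq> topspace Hilbert_cube \<and> X homeomorphic_space subtopology Hilbert_cube S \<longrightarrow>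
      (\<exists>U. openin Hilbert_cube U \<and> S \<subseteq> U \<and> S retract_of_space subtopology Hilbert_cube U))"


section \<open>Euclidean points\<close>

definition n_Euclidean_point :: "nat \<Rightarrow> 'a topology \<Rightarrow> 'a \<Rightarrow> bool"
  where "n_Euclidean_point n X x \<longleftrightarrow>
    1 \<le> n \<and> (\<exists>U. openin X U \<and> x \<in> U \<and> subtopology X U homeomorphic_space Euclidean_space n)"

definition Euclidean_point :: "'a topology \<Rightarrow> 'a \<Rightarrow> bool"
  where "Euclidean_point X x \<longleftrightarrow> (\<exists>n. n_Euclidean_point n X x)"

definition almost_Euclidean :: "'a topology \<Rightarrow> bool"
  where "almost_Euclidean X \<longleftrightarrow> Abstract_Topology.closure_of X {x. Euclidean_point X x} = topspace X"

definition almost_Euclidean_pair :: "'a topology \<Rightarrow> 'a set \<Rightarrow> bool"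
  where "almost_Euclidean_pair X A \<longleftrightarrow> almost_Euclidean (subtopology X (topspace X - A))"


section \<open>Regular cells\<close>

definition unit_ball :: "nat \<Rightarrow> (nat \<Rightarrow> real) set"
  where "unit_ball n = {x \<in> topspace (Euclidean_space n). (\<Sum>i<n. (x i)\<^sup>2) \<le> 1}"

definition unit_sphere :: "nat \<Rightarrow> (nat \<Rightarrow> real) set"
  where "unit_sphere n = {x \<in> topspace (Euclidean_space n). (\<Sum>i<n. (x i)\<^sup>2) = 1}"

definition regular_cell_map :: "nat \<Rightarrow> 'a topology \<Rightarrow> 'a set \<Rightarrow> ((nat \<Rightarrow> real) \<Rightarrow> 'a) \<Rightarrow> bool"
  where "regular_cell_map n X C f \<longleftrightarrow>
    homeomorphic_map (subtopology (Euclidean_space n) (unit_ball n)) (subtopology X C) f \<and>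
    openin X (f ` (unit_ball n - unit_sphere n))"

definition regular_n_cell :: "nat \<Rightarrow> 'a topology \<Rightarrow> 'a set \<Rightarrow> bool"
  where "regular_n_cell n X C \<longleftrightarrow> 1 \<le> n \<and> C \<subseteq> topspace X \<and> (\<exists>f. regular_cell_map n X C f)"

text \<open>The open cell does not depend on the choice of the map, by invariance of domain;
  see \<open>open_cell_eq\<close> below.\<close>

definition open_cell :: "nat \<Rightarrow> 'a topology \<Rightarrow> 'a set \<Rightarrow> 'a set"
  where "open_cell n X C =
    (THE U. \<exists>f. regular_cell_map n X C f \<and> U = f ` (unit_ball n - unit_sphere n))"

text \<open>Non-triviality of the canonical homomorphism
  $H_n(X,A;\mathbb{R}/\mathbb{Z}) \to H_n(X,X \setminus \mathrm{op}(C);\mathbb{R}/\mathbb{Z})$.\<close>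

definition belongs_to_relative_cycle :: "nat \<Rightarrow> 'a topology \<Rightarrow> 'a set \<Rightarrow> 'a set \<Rightarrow> bool"
  where "belongs_to_relative_cycle n X A C \<longleftrightarrow>
    (\<exists>K \<in> carrier (coeff_homology_group n X A :: ('a, circle_group) coeff_chain set monoid).
       coeff_inclusion_hom n X (topspace X - open_cell n X C) K
         \<noteq> \<one>\<^bsub>coeff_homology_group n X (topspace X - open_cell n X C)\<^esub>)"


subsection \<open>The open cell is well defined\<close>

lemma unit_ball_minus_sphere:
  "unit_ball n - unit_sphere n = {x \<in> topspace (Euclidean_space n). (\<Sum>i<n. (x i)\<^sup>2) < 1}"
  by (auto simp: unit_ball_def unit_sphere_def)

lemma continuous_map_sum_squares:
  "continuous_map (Euclidean_space n) euclideanreal (\<lambda>x. \<Sum>i<n. (x i)\<^sup>2)"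
  unfolding Euclidean_space_def
  by (intro continuous_map_sum continuous_map_real_pow continuous_map_from_subtopology
      continuous_map_product_projection) auto

lemma openin_unit_ball_interior: "openin (Euclidean_space n) (unit_ball n - unit_sphere n)"
proof -
  have "openin (Euclidean_space n)
          {x \<in> topspace (Euclidean_space n). (\<Sum>i<n. (x i)\<^sup>2) \<in> {..<1}}"
    by (rule openin_continuous_map_preimage [OF continuous_map_sum_squares]) simp
  then show ?thesis
    by (simp add: unit_ball_minus_sphere)
qed

lemma openin_subset_unit_ball:
  assumes U: "openin (Euclidean_space n) U" and sub: "U \<subseteq> unit_ball n"
  shows "U \<subseteq> unit_ball n - unit_sphere n"
proof
  fix x assume x: "x \<in> U"
  have xn: "x i = 0" if "i \<ge> n" for i
    using x sub that by (auto simp: unit_ball_def topspace_Euclidean_space)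
  have cont: "continuous_map euclideanreal (Euclidean_space n) (\<lambda>t i. t * x i)"
    unfolding Euclidean_space_def continuous_map_in_subtopology continuous_map_componentwise_UNIV
    by (auto simp: xn intro!: continuous_intros)
  have "openin euclideanreal {t \<in> topspace euclideanreal. (\<lambda>i. t * x i) \<in> U}"
    by (rule openin_continuous_map_preimage [OF cont U])
  then have "open {t. (\<lambda>i. t * x i) \<in> U}"
    by simp
  moreover have "1 \<in> {t. (\<lambda>i. t * x i) \<in> U}"
    using x by simp
  ultimately obtain e where "e > 0" and e: "\<And>t. dist t 1 < e \<Longrightarrow> (\<lambda>i. t * x i) \<in> U"
    unfolding open_dist by blast
  have "(\<lambda>i. (1 + e/2) * x i) \<in> unit_ball n"
    using e [of "1 + e/2"] \<open>e > 0\<close> sub by (auto simp: dist_real_def)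
  then have *: "(1 + e/2)\<^sup>2 * (\<Sum>i<n. (x i)\<^sup>2) \<le> 1"
    by (simp add: unit_ball_def power_mult_distrib sum_distrib_left)
  have "(\<Sum>i<n. (x i)\<^sup>2) \<noteq> 1"
  proof
    assume "(\<Sum>i<n. (x i)\<^sup>2) = 1"
    with * have "(1 + e/2)\<^sup>2 \<le> 1"
      by simp
    moreover have "1 < (1 + e/2)\<^sup>2"
      using one_less_power [of "1 + e/2" 2] \<open>e > 0\<close> by simp
    ultimately show False
      by simp
  qed
  then show "x \<in> unit_ball n - unit_sphere n"
    using x sub by (auto simp: unit_sphere_def)
qed

lemma regular_cell_map_interior_subset:
  assumes f: "regular_cell_map n X C f" and g: "regular_cell_map n X C g"
  shows "f ` (unit_ball n - unit_sphere n) \<subseteq> g ` (unit_ball n - unit_sphere n)"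
proof -
  let ?B = "subtopology (Euclidean_space n) (unit_ball n)"
  let ?I = "unit_ball n - unit_sphere n"
  have tB: "topspace ?B = unit_ball n"
    by (auto simp: unit_ball_def)
  have fh: "homeomorphic_map ?B (subtopology X C) f"
    using f by (simp add: regular_cell_map_def)
  obtain g' where g': "homeomorphic_maps ?B (subtopology X C) g g'"
    using g by (auto simp: regular_cell_map_def homeomorphic_map_maps)
  have g'h: "homeomorphic_map (subtopology X C) ?B g'"
    using g' homeomorphic_maps_map by blast
  have h: "homeomorphic_map ?B ?B (g' \<circ> f)"
    using homeomorphic_map_compose [OF fh g'h] .
  have cont: "continuous_map (subtopology (Euclidean_space n) ?I) (Euclidean_space n) (g' \<circ> f)"
    using homeomorphic_imp_continuous_map [OF h]
    by (meson Diff_subset continuous_map_from_subtopology_mono continuous_map_in_subtopology)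
  have inj: "inj_on (g' \<circ> f) ?I"
    using homeomorphic_imp_injective_map [OF h] unfolding tB by (rule inj_on_subset) auto
  have "openin (Euclidean_space n) ((g' \<circ> f) ` ?I)"
    by (rule invariance_of_domain_Euclidean_space [OF openin_unit_ball_interior cont inj])
  moreover have "(g' \<circ> f) ` ?I \<subseteq> unit_ball n"
    using homeomorphic_imp_surjective_map [OF h] unfolding tB by auto
  ultimately have sub: "(g' \<circ> f) ` ?I \<subseteq> ?I"
    by (rule openin_subset_unit_ball)
  have "f x \<in> g ` ?I" if "x \<in> ?I" for x
  proof -
    have "f x \<in> topspace (subtopology X C)"
      using homeomorphic_imp_surjective_map [OF fh] that unfolding tB by auto
    then have "g (g' (f x)) = f x"
      using g' by (simp add: homeomorphic_maps_def)
    moreover have "g' (f x) \<in> ?I"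
      using sub that by auto
    ultimately show ?thesis
      by (metis imageI)
  qed
  then show ?thesis
    by blast
qed

lemma open_cell_eq:
  assumes "regular_cell_map n X C f"
  shows "open_cell n X C = f ` (unit_ball n - unit_sphere n)"
  unfolding open_cell_def
proof (rule the_equality)
  fix U assume "\<exists>g. regular_cell_map n X C g \<and> U = g ` (unit_ball n - unit_sphere n)"
  then obtain g where g: "regular_cell_map n X C g"
      and U: "U = g ` (unit_ball n - unit_sphere n)"
    by blast
  show "U = f ` (unit_ball n - unit_sphere n)"
    unfolding U
    by (intro subset_antisym regular_cell_map_interior_subset [OF g assms]
        regular_cell_map_interior_subset [OF assms g])
qed (use assms in blast)


section \<open>The $\epsilon$-surjection property\<close>

definition eps_surjection_property ::
    "'a topology \<Rightarrow> 'a set \<Rightarrow> ('a \<Rightarrow> 'a \<Rightarrow> real) \<Rightarrow> real \<Rightarrow> bool"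
  where "eps_surjection_property X A d \<epsilon> \<longleftrightarrow>
    (\<forall>f. continuous_map X X f \<and> (\<forall>a\<in>A. f a = a) \<and> (\<forall>x\<in>topspace X. d (f x) x < \<epsilon>)
      \<longrightarrow> f ` topspace X = topspace X)"

end

theory Submission
  imports Defs
begin

text \<open>The idea is that a map \<open>f\<close> close to the identity acts as the identity on homology, whereas a map
  that misses a cell kills the classes that pass through this cell.

  Embed the compact ANR \<open>X\<close> in the Hilbert cube and retract a neighborhood onto it. If \<open>f\<close> moves points
  by little, then the segments from \<open>f x\<close> to \<open>x\<close> stay in that neighborhood, and retracting them
  gives a homotopy from \<open>f\<close> to the identity. It is stationary at the fixed points of \<open>f\<close>, hence on \<open>A\<close>
  (\<open>compact_ANR_uniformly_locally_equiconnected\<close>). If \<open>f\<close> is not onto, then the complement of its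
  image is a nonempty open set disjoint from \<open>A\<close>, so by density of the Euclidean points it contains a
  regular cell \<open>C\<close> (\<open>almost_Euclidean_pair_has_regular_cell\<close>). The canonical homomorphism from
  $H_n(X, A)$ to $H_n(X, X \setminus \mathrm{op}(C))$ is unchanged by composition with \<open>f\<close>, but \<open>f\<close>
  maps \<open>X\<close> into \<open>X - C\<close>; so the homomorphism is zero
  (\<open>coeff_relcycle_imp_relboundary_homotopy\<close>), contrary to the hypothesis on regular cells.

  Homotopy invariance is needed here for homology with circle coefficients and at the level of
  relative chains. It comes from a natural chain homotopy with integer coefficients, the prism
  operator, constructed by acyclic models (\<open>prism_over_exists\<close>): its value on the identity of the
  standard simplex is any chain with the prescribed boundary, which exists because the cylinder over
  the simplex is contractible, and naturality determines all other values. The extension of scalars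
  \<open>coeff_ext\<close> carries it over to arbitrary coefficients.\<close>


section \<open>Extension of scalars for integer chain operators\<close>

text \<open>The module structure over the integers of an abelian group is borrowed from the integer powers in
  the group formed by its elements, so that both distributive laws are laws of powers.\<close>

definition int_scale :: "int \<Rightarrow> 'g::ab_group_add \<Rightarrow> 'g"
  where "int_scale n g = g [^]\<^bsub>\<lparr>carrier = UNIV, mult = (+), one = 0\<rparr>\<^esub> n"

lemma comm_group_additive:
  "comm_group \<lparr>carrier = (UNIV :: 'g::ab_group_add set), mult = (+), one = 0\<rparr>"
proof (rule comm_groupI)
  show "\<exists>y\<in>carrier \<lparr>carrier = UNIV, mult = (+), one = 0\<rparr>.
          y \<otimes>\<^bsub>\<lparr>carrier = UNIV, mult = (+), one = 0\<rparr>\<^esub> x = \<one>\<^bsub>\<lparr>carrier = UNIV, mult = (+), one = 0\<rparr>\<^esub>"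
    for x :: 'g
    by (intro bexI [of _ "- x"]) auto
qed (auto simp: algebra_simps)

lemma int_scale_add_left: "int_scale (m + n) g = int_scale m g + int_scale n g"
  using group.int_pow_mult [OF comm_group.axioms(2) [OF comm_group_additive], of g m n]
  by (simp add: int_scale_def)

lemma int_scale_add_right: "int_scale n (g + h) = int_scale n g + int_scale n h"
  using comm_group.int_pow_distrib [OF comm_group_additive, of g h n]
  by (simp add: int_scale_def)

lemma int_scale_1 [simp]: "int_scale 1 g = g"
  using group.int_pow_1 [OF comm_group.axioms(2) [OF comm_group_additive], of g]
  by (simp add: int_scale_def)

lemma int_scale_0 [simp]: "int_scale 0 g = 0"
  using int_scale_add_left [of 0 0 g] by simp

lemma int_scale_0_right [simp]: "int_scale n 0 = 0"
  using int_scale_add_right [of n 0 0] by simp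

text \<open>The elementary tensor of an integer chain \<open>w\<close> and a coefficient \<open>g\<close>, under the usual identification
  of $\mathbb{Z}^{(B)} \otimes G$ with $G^{(B)}$.\<close>

definition tensor :: "('b \<Rightarrow>\<^sub>0 int) \<Rightarrow> 'g::ab_group_add \<Rightarrow> ('b \<Rightarrow>\<^sub>0 'g)"
  where "tensor w g = Poly_Mapping.map (\<lambda>n. int_scale n g) w"

lemma lookup_tensor: "Poly_Mapping.lookup (tensor w g) s = int_scale (Poly_Mapping.lookup w s) g"
  by (simp add: tensor_def Poly_Mapping.map.rep_eq when_def)

lemma keys_tensor_subset: "Poly_Mapping.keys (tensor w g) \<subseteq> Poly_Mapping.keys w"
  by (auto simp: in_keys_iff lookup_tensor)

lemma tensor_add_left: "tensor (v + w) g = tensor v g + tensor w g"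
  by (rule poly_mapping_eqI) (simp add: lookup_tensor lookup_add int_scale_add_left)

lemma tensor_add_right: "tensor w (g + h) = tensor w g + tensor w h"
  by (rule poly_mapping_eqI) (simp add: lookup_tensor lookup_add int_scale_add_right)

lemma tensor_0_left [simp]: "tensor 0 g = 0"
  by (rule poly_mapping_eqI) (simp add: lookup_tensor)

lemma tensor_0_right [simp]: "tensor w 0 = 0"
  by (rule poly_mapping_eqI) (simp add: lookup_tensor)

lemma tensor_diff_left: "tensor (v - w) g = tensor v g - tensor w g"
  using tensor_add_left [of "v - w" w g] by simp

lemma tensor_minus_left: "tensor (- w) g = - tensor w g"
  using tensor_add_left [of "- w" w g] by (simp add: eq_neg_iff_add_eq_0)

lemma tensor_sum_left: "tensor (sum f I) g = (\<Sum>i\<in>I. tensor (f i) g)"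
  by (induction I rule: infinite_finite_induct) (simp_all add: tensor_add_left)

lemma tensor_frag_of [simp]: "tensor (frag_of s) g = Poly_Mapping.single s g"
  by (rule poly_mapping_eqI) (simp add: lookup_tensor lookup_single when_def)

text \<open>A homomorphism $\mathbb{Z}^{(A)} \to \mathbb{Z}^{(B)}$ of free groups is given by its values \<open>F\<close> on the
  basis; this is its tensor product with the identity of the coefficient group.\<close>

definition coeff_ext :: "('a \<Rightarrow> ('b \<Rightarrow>\<^sub>0 int)) \<Rightarrow> ('a \<Rightarrow>\<^sub>0 'g::ab_group_add) \<Rightarrow> ('b \<Rightarrow>\<^sub>0 'g)"
  where "coeff_ext F c = (\<Sum>s\<in>Poly_Mapping.keys c. tensor (F s) (Poly_Mapping.lookup c s))"

lemma coeff_ext_superset: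
  assumes "finite I" "Poly_Mapping.keys c \<subseteq> I"
  shows "coeff_ext F c = (\<Sum>s\<in>I. tensor (F s) (Poly_Mapping.lookup c s))"
  unfolding coeff_ext_def
  by (rule sum.mono_neutral_left [OF assms]) (simp add: in_keys_iff)

lemma coeff_ext_add: "coeff_ext F (a + b) = coeff_ext F a + coeff_ext F b"
proof -
  let ?I = "Poly_Mapping.keys a \<union> Poly_Mapping.keys b"
  have *: "finite ?I" "Poly_Mapping.keys a \<subseteq> ?I" "Poly_Mapping.keys b \<subseteq> ?I"
    "Poly_Mapping.keys (a + b) \<subseteq> ?I"
    using keys_add [of a b] by auto
  show ?thesis
    by (simp add: coeff_ext_superset [OF *(1,2)] coeff_ext_superset [OF *(1,3)]
        coeff_ext_superset [OF *(1,4)] lookup_add tensor_add_right sum.distrib)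
qed

lemma coeff_ext_0 [simp]: "coeff_ext F 0 = 0"
  by (simp add: coeff_ext_def)

lemma coeff_ext_diff: "coeff_ext F (a - b) = coeff_ext F a - coeff_ext F b"
  using coeff_ext_add [of F "a - b" b] by simp

lemma coeff_ext_sum: "coeff_ext F (sum f I) = (\<Sum>i\<in>I. coeff_ext F (f i))"
  by (induction I rule: infinite_finite_induct) (simp_all add: coeff_ext_add)

lemma coeff_ext_single [simp]: "coeff_ext F (Poly_Mapping.single s g) = tensor (F s) g"
  by (subst coeff_ext_superset [where I = "{s}"]) (simp_all add: lookup_single)

lemma coeff_ext_tensor: "coeff_ext F (tensor w g) = tensor (frag_extend F w) g"
  using subset_UNIV
  by (induction w rule: frag_induction) (simp_all add: tensor_diff_left coeff_ext_diff frag_extend_diff)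

text \<open>Together with the rules for differences and identities below, functoriality lets an identity between
  integer chain operators, checked on single simplices, pass to arbitrary coefficients. This is how
  a chain homotopy with integer coefficients yields one with coefficients in the circle group.\<close>

lemma coeff_ext_compose:
  "coeff_ext G (coeff_ext F c) = coeff_ext (\<lambda>s. frag_extend G (F s)) c"
  unfolding coeff_ext_def [of F] coeff_ext_sum coeff_ext_tensor by (simp add: coeff_ext_def)

lemma coeff_ext_diff_operator:
  "coeff_ext (\<lambda>s. F s - G s) c = coeff_ext F c - coeff_ext G c"
  by (simp add: coeff_ext_def tensor_diff_left sum_subtractf)

lemma coeff_ext_frag_of [simp]: "coeff_ext frag_of c = c"
  unfolding coeff_ext_def tensor_frag_of by (rule poly_mapping_sum_single [symmetric])

lemma coeff_ext_cong:
  "(\<And>s. s \<in> Poly_Mapping.keys c \<Longrightarrow> F s = G s) \<Longrightarrow> coeff_ext F c = coeff_ext G c"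
  by (simp add: coeff_ext_def)

lemma coeff_singular_chain_ext:
  assumes "coeff_singular_chain p X c"
    and "\<And>s. singular_simplex p X s \<Longrightarrow> singular_chain q Y (F s)"
  shows "coeff_singular_chain q Y (coeff_ext F c)"
  unfolding coeff_ext_def
proof (rule coeff_singular_chain_sum)
  fix s assume "s \<in> Poly_Mapping.keys c"
  then have "singular_chain q Y (F s)"
    using assms by (auto simp: coeff_singular_chain_def)
  then show "coeff_singular_chain q Y (tensor (F s) (Poly_Mapping.lookup c s))"
    unfolding coeff_singular_chain_def singular_chain_def using keys_tensor_subset by fast
qed

lemma tensor_sign:
  "tensor (frag_cmul ((-1) ^ k) (frag_of t)) g = Poly_Mapping.single t (if even k then g else - g)"
  by (cases "even k") (simp_all add: tensor_minus_left single_uminus)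

lemma coeff_boundary_eq_ext:
  "coeff_boundary p c = coeff_ext (\<lambda>s. chain_boundary p (frag_of s)) c"
proof (cases "p = 0")
  case False
  then show ?thesis
    by (simp add: coeff_boundary_def coeff_ext_def chain_boundary_of tensor_sum_left tensor_sign)
qed (simp add: coeff_boundary_def coeff_ext_def chain_boundary_def)


section \<open>The prism operator\<close>

abbreviation geometric_simplex :: "nat \<Rightarrow> (nat \<Rightarrow> real) topology"
  where "geometric_simplex p \<equiv> subtopology (powertop_real UNIV) (standard_simplex p)"

abbreviation cylinder :: "'a topology \<Rightarrow> (real \<times> 'a) topology"
  where "cylinder X \<equiv> prod_topology (top_of_set {0..1}) X"

text \<open>The identity of the standard simplex, seen as a singular simplex in it. It is universal: a singular
  simplex \<open>s\<close> is its image under the chain map induced by \<open>s\<close> itself.\<close>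

abbreviation tautological_simplex :: "nat \<Rightarrow> (nat \<Rightarrow> real) chain"
  where "tautological_simplex p \<equiv> frag_of (restrict id (standard_simplex p))"

lemma singular_chain_tautological_simplex:
  "singular_chain p (geometric_simplex p) (tautological_simplex p)"
  unfolding singular_chain_of singular_simplex_def
  by (auto intro: continuous_map_eq [where f = id])

lemma continuous_map_cylinder_end:
  "t \<in> {0..1} \<Longrightarrow> continuous_map X (cylinder X) (Pair t)"
  by (simp add: continuous_map_pairwise o_def)

lemma continuous_map_cylinder_simplex:
  assumes "singular_simplex p X s"
  shows "continuous_map (cylinder (geometric_simplex p)) (cylinder X) (map_prod id s)"
  using assms unfolding singular_simplex_def map_prod_def
  by (auto simp: continuous_map_prod_top)

text \<open>A chain \<open>W\<close> in the cylinder over the standard simplex acts on every singular simplex \<open>s\<close> of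
  every space, by transport along $\mathrm{id} \times s$. Operators of this shape are natural by
  construction, which is what allows their values to be determined on the universal simplex only.\<close>

definition sweep :: "(real \<times> (nat \<Rightarrow> real)) chain \<Rightarrow> nat \<Rightarrow> 'a chain \<Rightarrow> (real \<times> 'a) chain"
  where "sweep W p = frag_extend (\<lambda>s. chain_map (Suc p) (map_prod id s) W)"

lemma sweep_of [simp]: "sweep W p (frag_of s) = chain_map (Suc p) (map_prod id s) W"
  by (simp add: sweep_def)

lemma sweep_0 [simp]: "sweep W p 0 = 0"
  by (simp add: sweep_def)

lemma sweep_diff: "sweep W p (a - b) = sweep W p a - sweep W p b"
  by (simp add: sweep_def frag_extend_diff)

lemma singular_chain_sweep:
  assumes W: "singular_chain (Suc p) (cylinder (geometric_simplex p)) W"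
    and c: "singular_chain p X c"
  shows "singular_chain (Suc p) (cylinder X) (sweep W p c)"
  unfolding sweep_def
proof (rule singular_chain_extend)
  fix s assume "s \<in> Poly_Mapping.keys c"
  then have "singular_simplex p X s"
    using c by (auto simp: singular_chain_def)
  then show "singular_chain (Suc p) (cylinder X) (chain_map (Suc p) (map_prod id s) W)"
    by (intro singular_chain_chain_map [OF W] continuous_map_cylinder_simplex)
qed

lemma sweep_chain_map:
  assumes W: "singular_chain (Suc p) (cylinder (geometric_simplex p)) W"
  shows "sweep W p (chain_map p f c) = chain_map (Suc p) (map_prod id f) (sweep W p c)"
  using subset_UNIV
proof (induction c rule: frag_induction)
  case (one s)
  have "sweep W p (chain_map p f (frag_of s)) = chain_map (Suc p) (map_prod id f \<circ> map_prod id s) W"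
    by simp (rule chain_map_eq [OF W], auto simp: simplex_map_def)
  then show ?case
    by (simp only: chain_map_compose comp_apply sweep_of)
qed (simp_all add: chain_map_diff sweep_diff)

text \<open>\<open>W\<close> fills the prism over the standard simplex: its boundary is the top minus the bottom minus the
  sides, and the sides are swept out by the filling \<open>V\<close> chosen one dimension lower.\<close>

definition prism_over :: "nat \<Rightarrow> (real \<times> (nat \<Rightarrow> real)) chain \<Rightarrow> (real \<times> (nat \<Rightarrow> real)) chain \<Rightarrow> bool"
  where "prism_over p V W \<longleftrightarrow>
    singular_chain (Suc p) (cylinder (geometric_simplex p)) W \<and>
    chain_boundary (Suc p) W =
      chain_map p (Pair 1) (tautological_simplex p) - chain_map p (Pair 0) (tautological_simplex p)
      - sweep V (p - 1) (chain_boundary p (tautological_simplex p))"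

text \<open>The boundary formula required for the universal simplex holds for all chains in all spaces, because
  each term is natural and every simplex is an image of the universal one.\<close>

lemma chain_boundary_sweep:
  assumes W: "prism_over p V W"
    and V: "p > 0 \<Longrightarrow> singular_chain p (cylinder (geometric_simplex (p - 1))) V"
    and c: "singular_chain p X c"
  shows "chain_boundary (Suc p) (sweep W p c) =
    chain_map p (Pair 1) c - chain_map p (Pair 0) c - sweep V (p - 1) (chain_boundary p c)"
  using c unfolding singular_chain_def
proof (induction c rule: frag_induction)
  case (one s)
  let ?g = "map_prod id s" and ?\<iota> = "tautological_simplex p"
  have s: "chain_map p s ?\<iota> = frag_of s"
    using one by (intro singular_simplex_chain_map_id [where X=X]) simp
  have ends: "chain_map p ?g (chain_map p (Pair t) ?\<iota>) = chain_map p (Pair t) (frag_of s)" for t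
  proof -
    have "?g \<circ> Pair t = Pair t \<circ> s"
      by auto
    then show ?thesis
      unfolding s [symmetric] by (metis chain_map_compose comp_apply)
  qed
  have "chain_map p ?g (sweep V (p - 1) (chain_boundary p ?\<iota>)) = sweep V (p - 1) (chain_boundary p (frag_of s))"
  proof (cases p)
    case (Suc q)
    have "chain_boundary p (frag_of s) = chain_map q s (chain_boundary p ?\<iota>)"
      unfolding s [symmetric]
      using chain_boundary_chain_map [OF singular_chain_tautological_simplex, of p s] Suc by simp
    then show ?thesis
      using sweep_chain_map [of q V s "chain_boundary p ?\<iota>"] V Suc by simp
  qed (simp add: chain_boundary_def)
  then have "chain_boundary (Suc p) (chain_map (Suc p) ?g W) =
      chain_map p (Pair 1) (frag_of s) - chain_map p (Pair 0) (frag_of s)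
      - sweep V (p - 1) (chain_boundary p (frag_of s))"
    using W chain_boundary_chain_map [of "Suc p" _ W ?g]
    unfolding prism_over_def by (auto simp only: chain_map_diff ends diff_Suc_Suc minus_nat.diff_0 One_nat_def)
  then show ?case
    by simp
qed (simp_all add: chain_boundary_diff sweep_diff chain_map_diff)

text \<open>A contraction makes a cycle homologous to its image in a one-point space, where all cycles of
  positive dimension bound.\<close>

lemma singular_cycle_imp_boundary_contractible:
  assumes Y: "contractible_space Y" and c: "singular_relcycle p Y {} c" and "p \<noteq> 0"
  shows "singular_relboundary p Y {} c"
proof (cases "Y = trivial_topology")
  case True
  then show ?thesis
    using c by (simp add: singular_relcycle singular_chain_empty)
next
  case False
  then obtain a where a: "a \<in> topspace Y" and h: "homotopic_with (\<lambda>x. True) Y Y id (\<lambda>x. a)"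
    using Y unfolding contractible_space by blast
  have tp: "topspace (subtopology Y {a}) = {a}"
    using a by auto
  have "homologous_rel p Y {} (chain_map p id c) (chain_map p (\<lambda>x. a) c)"
    by (rule homotopic_imp_homologous_rel_chain_maps [OF _ c]) (use h in simp)
  moreover have "chain_map p id c = c"
    using c by (intro chain_map_ident) (auto simp: singular_relcycle)
  moreover have "singular_relcycle p (subtopology Y {a}) {} (chain_map p (\<lambda>x. a) c)"
    by (rule singular_relcycle_chain_map [OF c]) (use a in auto)
  then have "singular_relboundary p (subtopology Y {a}) {} (chain_map p (\<lambda>x. a) c)"
    using \<open>p \<noteq> 0\<close> by (auto simp: singular_cycle_singleton [OF tp] singular_boundary_singleton [OF tp])
  then have "singular_relboundary p Y {} (chain_map p (\<lambda>x. a) c)"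
    using singular_boundary_mono [of "{a}" "topspace Y" p Y] a by simp
  ultimately show ?thesis
    unfolding homologous_rel_def using singular_relboundary_add by fastforce
qed

lemma contractible_geometric_simplex: "contractible_space (geometric_simplex p)"
proof -
  define b :: "nat \<Rightarrow> real" where "b = (\<lambda>j. if j = 0 then 1 else 0)"
  have b: "b \<in> standard_simplex p"
    by (simp add: b_def)
  let ?h = "\<lambda>(t, x) i. (1 - t) * x i + t * b i"
  have "continuous_map (cylinder (geometric_simplex p)) (geometric_simplex p) ?h"
    unfolding continuous_map_in_subtopology
  proof (intro conjI)
    show "continuous_map (cylinder (geometric_simplex p)) (powertop_real UNIV) ?h"
      unfolding continuous_map_componentwise_UNIV case_prod_unfold
    proof
      fix i :: nat
      have "continuous_map (cylinder (geometric_simplex p)) euclideanreal (\<lambda>z. snd z i)"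
        using continuous_map_compose [OF continuous_map_snd continuous_map_from_subtopology
            [OF continuous_map_product_projection [of i UNIV "\<lambda>i. euclideanreal"]]]
        by (simp add: o_def)
      moreover have "continuous_map (cylinder (geometric_simplex p)) euclideanreal fst"
        by (metis continuous_map_fst continuous_map_into_fulltopology)
      ultimately show "continuous_map (cylinder (geometric_simplex p)) euclideanreal
          (\<lambda>z. (1 - fst z) * snd z i + fst z * b i)"
        by (intro continuous_intros)
    qed
    show "?h \<in> topspace (cylinder (geometric_simplex p)) \<rightarrow> standard_simplex p"
      using b by (auto intro!: convex_standard_simplex)
  qed
  then have "homotopic_with (\<lambda>x. True) (geometric_simplex p) (geometric_simplex p) id (\<lambda>x. b)"
    unfolding homotopic_with_def by (intro exI [of _ ?h]) (auto simp: fun_eq_iff)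
  then show ?thesis
    unfolding contractible_space_def by blast
qed

lemma contractible_cylinder: "contractible_space X \<Longrightarrow> contractible_space (cylinder X)"
  by (simp add: contractible_space_prod_topology convex_imp_contractible)

text \<open>The method of acyclic models: the prescribed boundary is a cycle, by the boundary formula one
  dimension lower and $\partial\partial = 0$, and the cylinder over a simplex is contractible, so that
  the cycle bounds. In dimension 0 a contraction does not suffice, since points are cycles that do not
  bound; there the two ends are joined by the homotopy that runs along the cylinder.\<close>

lemma prism_over_exists:
  assumes V: "p > 0 \<Longrightarrow> prism_over (p - 1) U V"
    and U: "p > 1 \<Longrightarrow> singular_chain (p - 1) (cylinder (geometric_simplex (p - 2))) U"
  shows "\<exists>W. prism_over p V W"
proof -
  let ?\<iota> = "tautological_simplex p" and ?Y = "cylinder (geometric_simplex p)"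
  let ?R = "chain_map p (Pair 1) ?\<iota> - chain_map p (Pair 0) ?\<iota> - sweep V (p - 1) (chain_boundary p ?\<iota>)"
  have "singular_relboundary p ?Y {} ?R"
  proof (cases p)
    case 0
    have "homotopic_with (\<lambda>h. h \<in> {} \<rightarrow> {}) (geometric_simplex p) ?Y (Pair (1::real)) (Pair 0)"
      unfolding homotopic_with_def
    proof (intro exI [of _ "\<lambda>(t, x). (1 - t, x)"] conjI)
      have "continuous_map (cylinder (geometric_simplex p)) (top_of_set {0..1}) (\<lambda>z. 1 - fst z)"
        unfolding continuous_map_in_subtopology
        by (auto intro!: continuous_intros intro: continuous_map_into_fulltopology [OF continuous_map_fst])
      then show "continuous_map (cylinder (geometric_simplex p)) ?Y (\<lambda>(t, x). (1 - t, x))"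
        by (auto simp: case_prod_unfold continuous_map_pairwise o_def continuous_map_snd)
    qed auto
    moreover have "singular_relcycle p (geometric_simplex p) {} ?\<iota>"
      using singular_chain_tautological_simplex [of p] by (simp add: singular_cycle 0 chain_boundary_def)
    ultimately have "homologous_rel p ?Y {} (chain_map p (Pair 1) ?\<iota>) (chain_map p (Pair 0) ?\<iota>)"
      by (rule homotopic_imp_homologous_rel_chain_maps)
    then show ?thesis
      by (simp add: homologous_rel_def 0 chain_boundary_def)
  next
    case (Suc q)
    have d\<iota>: "singular_chain q (geometric_simplex p) (chain_boundary p ?\<iota>)"
      using singular_chain_boundary [OF singular_chain_tautological_simplex [of p]] by (simp add: Suc)
    have Vc: "singular_chain (Suc q) (cylinder (geometric_simplex q)) V"
      using V by (simp add: Suc prism_over_def)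
    have "chain_boundary p (sweep V q (chain_boundary p ?\<iota>)) =
       chain_map q (Pair 1) (chain_boundary p ?\<iota>) - chain_map q (Pair 0) (chain_boundary p ?\<iota>)
       - sweep U (q - 1) (chain_boundary q (chain_boundary p ?\<iota>))"
      using chain_boundary_sweep [OF _ _ d\<iota>, of U V] V U by (simp add: Suc)
    moreover have "chain_boundary q (chain_boundary p ?\<iota>) = 0"
      using chain_boundary_boundary_alt singular_chain_tautological_simplex by (metis Suc)
    moreover have "chain_boundary p (chain_map p (Pair t) ?\<iota>) = chain_map q (Pair t) (chain_boundary p ?\<iota>)" for t :: real
      using chain_boundary_chain_map [OF singular_chain_tautological_simplex [of p], of "Pair t"] by (simp add: Suc)
    ultimately have "chain_boundary p ?R = 0"
      by (simp only: chain_boundary_diff sweep_0) (simp add: Suc chain_boundary_diff)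
    moreover have "singular_chain p ?Y ?R"
      by (intro singular_chain_diff singular_chain_chain_map [OF singular_chain_tautological_simplex]
          continuous_map_cylinder_end) (use singular_chain_sweep [OF Vc d\<iota>] Suc in auto)
    ultimately show ?thesis
      by (intro singular_cycle_imp_boundary_contractible contractible_cylinder contractible_geometric_simplex)
        (simp_all add: singular_cycle Suc)
  qed
  then show ?thesis
    by (auto simp: singular_boundary prism_over_def)
qed

primrec prism :: "nat \<Rightarrow> (real \<times> (nat \<Rightarrow> real)) chain" where
  "prism 0 = (SOME W. prism_over 0 0 W)"
| "prism (Suc p) = (SOME W. prism_over (Suc p) (prism p) W)"

lemma prism_over_prism: "prism_over p (prism (p - 1)) (prism p)"
proof (induction p rule: less_induct)
  case (less p)
  show ?case
  proof (cases p)
    case 0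
    have "\<exists>W. prism_over 0 0 W"
      by (rule prism_over_exists) auto
    then have "prism_over 0 0 (prism 0)"
      by (simp add: someI_ex)
    then show ?thesis
      by (simp add: 0 prism_over_def chain_boundary_def)
  next
    case (Suc q)
    have "\<exists>W. prism_over (Suc q) (prism q) W"
    proof (rule prism_over_exists)
      show "prism_over (Suc q - 1) (prism (q - 1)) (prism q)"
        using less [of q] Suc by simp
      show "singular_chain (Suc q - 1) (cylinder (geometric_simplex (Suc q - 2))) (prism (q - 1))"
        if "Suc q > 1"
        using less [of "q - 1"] Suc that by (auto simp: prism_over_def)
    qed
    then show ?thesis
      by (simp add: Suc someI_ex)
  qed
qed

lemma singular_chain_prism:
  "singular_chain (Suc p) (cylinder (geometric_simplex p)) (prism p)"
  using prism_over_prism by (simp add: prism_over_def)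

lemma chain_boundary_sweep_prism:
  assumes "singular_chain p X c"
  shows "chain_boundary (Suc p) (sweep (prism p) p c) =
    chain_map p (Pair 1) c - chain_map p (Pair 0) c - sweep (prism (p - 1)) (p - 1) (chain_boundary p c)"
  using singular_chain_prism [of "p - 1"]
  by (intro chain_boundary_sweep [OF prism_over_prism _ assms]) simp


section \<open>Homotopies and relative cycles\<close>

text \<open>For $f = h(0, \cdot)$ the prism operator gives
  $c = \partial D c + f_\# c + D \partial c$. The chain $f_\# c$ lies in \<open>T\<close> because \<open>f\<close> maps
  everything there, and $D \partial c$ lies in \<open>S\<close> because the homotopy moves \<open>S\<close> within itself. In
  other words, a self-map of \<open>(X, S)\<close> with image in \<open>T\<close> factors through \<open>(T, T)\<close>, whose relative
  homology vanishes, and yet acts as the identity.\<close>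

lemma coeff_relcycle_imp_relboundary_homotopy:
  fixes c :: "('a, 'g::ab_group_add) coeff_chain"
  assumes h: "continuous_map (cylinder X) X h"
    and h0: "\<And>x. x \<in> topspace X \<Longrightarrow> h (0, x) \<in> T"
    and h1: "\<And>x. x \<in> topspace X \<Longrightarrow> h (1, x) = x"
    and hS: "\<And>t x. t \<in> {0..1} \<Longrightarrow> x \<in> S \<Longrightarrow> h (t, x) \<in> S"
    and "S \<subseteq> T"
    and c: "coeff_relcycle p X S c"
  shows "coeff_relboundary p X T c"
proof -
  (* D is the chain homotopy: sweep each simplex through the cylinder, then apply h. *)
  define D where "D q s = chain_map (Suc q) h (sweep (prism q) q (frag_of s))" for q s
  have D_extend: "frag_extend (D q) w = chain_map (Suc q) h (sweep (prism q) q w)" for q w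
    using subset_UNIV
    by (induction w rule: frag_induction) (auto simp: D_def frag_extend_diff sweep_diff chain_map_diff)
  have D_chain: "singular_chain (Suc q) Y (D q s)"
    if "singular_simplex q Y s" "continuous_map (cylinder Y) Y h" for q s Y
    unfolding D_def
    by (intro singular_chain_chain_map [OF _ that(2)] singular_chain_sweep)
      (use that in \<open>simp_all add: singular_chain_prism singular_chain_of\<close>)
  have hS: "continuous_map (cylinder (subtopology X S)) (subtopology X S) h"
    using h hS by (auto simp: continuous_map_in_subtopology prod_topology_subtopology(2)
        continuous_map_from_subtopology)
  have boundary_D: "frag_extend (\<lambda>t. chain_boundary (Suc p) (frag_of t)) (D p s) =
      frag_of s - chain_map p (\<lambda>x. h (0, x)) (frag_of s)
      - frag_extend (D (p - 1)) (chain_boundary p (frag_of s))"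
    if s: "singular_simplex p X s" for s
  proof -
    have "frag_extend (\<lambda>t. chain_boundary (Suc p) (frag_of t)) w = chain_boundary (Suc p) w"
      for w :: "'a chain"
      using subset_UNIV
      by (induction w rule: frag_induction) (auto simp: frag_extend_diff chain_boundary_diff)
    then have "frag_extend (\<lambda>t. chain_boundary (Suc p) (frag_of t)) (D p s) =
        chain_map p h (chain_boundary (Suc p) (sweep (prism p) p (frag_of s)))"
      unfolding D_def
      using chain_boundary_chain_map [OF singular_chain_sweep [of p "prism p" X "frag_of s"], of h]
        s by (simp add: singular_chain_prism singular_chain_of)
    also have "\<dots> = chain_map p (h \<circ> Pair 1) (frag_of s) - chain_map p (h \<circ> Pair 0) (frag_of s)
        - chain_map p h (sweep (prism (p - 1)) (p - 1) (chain_boundary p (frag_of s)))"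
      using s by (simp only: chain_boundary_sweep_prism singular_chain_of chain_map_diff
          chain_map_compose comp_apply)
    also have "chain_map p (h \<circ> Pair 1) (frag_of s) = frag_of s"
      using s h1 by (intro chain_map_id_gen [where X = X]) (auto simp: singular_chain_of)
    also have "chain_map p h (sweep (prism (p - 1)) (p - 1) (chain_boundary p (frag_of s))) =
        frag_extend (D (p - 1)) (chain_boundary p (frag_of s))"
      by (cases p) (simp_all add: D_extend chain_boundary_def)
    finally show ?thesis
      by (simp add: o_def)
  qed
  have keys: "\<And>s. s \<in> Poly_Mapping.keys c \<Longrightarrow> singular_simplex p X s"
    using c by (auto simp: coeff_relcycle_def coeff_singular_chain_def)
  define f where "f = coeff_ext (\<lambda>s. chain_map p (\<lambda>x. h (0, x)) (frag_of s)) c"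
  define b where "b = coeff_ext (D (p - 1)) (coeff_boundary p c)"
  have "coeff_boundary (Suc p) (coeff_ext (D p) c) =
      coeff_ext (\<lambda>s. frag_of s - chain_map p (\<lambda>x. h (0, x)) (frag_of s)
        - frag_extend (D (p - 1)) (chain_boundary p (frag_of s))) c"
    unfolding coeff_boundary_eq_ext coeff_ext_compose
    by (rule coeff_ext_cong) (simp only: boundary_D keys)
  also have "\<dots> = c - f - b"
    unfolding coeff_ext_diff_operator f_def b_def
    by (simp add: coeff_boundary_eq_ext coeff_ext_compose)
  finally have "c = coeff_boundary (Suc p) (coeff_ext (D p) c) + (f + b)"
    by simp
  moreover have "coeff_singular_chain (Suc p) X (coeff_ext (D p) c)"
    using c D_chain h by (intro coeff_singular_chain_ext [where p = p and X = X])
      (auto simp: coeff_relcycle_def)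
  moreover have "coeff_singular_chain p (subtopology X T) f"
    unfolding f_def
  proof (rule coeff_singular_chain_ext [where p = p and X = X])
    have "continuous_map X X (h \<circ> Pair 0)"
      by (rule continuous_map_compose [OF continuous_map_cylinder_end h]) simp
    then have "continuous_map X (subtopology X T) (\<lambda>x. h (0, x))"
      using h0 by (auto simp: continuous_map_in_subtopology o_def)
    then show "singular_chain p (subtopology X T) (chain_map p (\<lambda>x. h (0, x)) (frag_of s))"
      if "singular_simplex p X s" for s
      using that by (intro singular_chain_chain_map [where X = X]) (auto simp: singular_chain_of)
  qed (use c in \<open>simp add: coeff_relcycle_def\<close>)
  moreover have "coeff_singular_chain p (subtopology X S) b"
  proof (cases p)
    case 0
    then show ?thesis
      by (simp add: b_def coeff_boundary_def)
  next
    case (Suc q)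
    then show ?thesis
      unfolding b_def
      using c D_chain hS by (intro coeff_singular_chain_ext [where p = q and X = "subtopology X S"])
        (auto simp: coeff_relcycle_def)
  qed
  ultimately show ?thesis
    unfolding coeff_relboundary_def
    using coeff_singular_chain_add coeff_singular_chain_mono [OF \<open>S \<subseteq> T\<close>] by blast
qed


section \<open>Compact ANRs are uniformly locally equiconnected\<close>


lemma continuous_map_Hilbert_cube:
  "continuous_map X Hilbert_cube f \<longleftrightarrow>
    (\<forall>i. continuous_map X euclideanreal (\<lambda>x. f x i)) \<and>
    (\<forall>x\<in>topspace X. \<forall>i. 0 \<le> f x i \<and> f x i \<le> 1)"
  unfolding Hilbert_cube_def continuous_map_componentwise_UNIV continuous_map_in_subtopology
  by (auto simp: Pi_iff)

lemma Hausdorff_space_Hilbert_cube: "Hausdorff_space Hilbert_cube"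
  unfolding Hilbert_cube_def by (simp add: Hausdorff_space_product_topology Hausdorff_space_subtopology)

lemma compact_metric_countable_dense:
  assumes d: "Metric_space (topspace X) d" and X: "Metric_space.mtopology (topspace X) d = X"
    and "compact_space X"
  obtains Q where "countable Q" "Q \<subseteq> topspace X"
    "\<And>x e. x \<in> topspace X \<Longrightarrow> 0 < e \<Longrightarrow> \<exists>q\<in>Q. d q x < e"
proof -
  interpret Metric_space "topspace X" d by (fact d)
  have "mtotally_bounded (topspace X)"
    using \<open>compact_space X\<close> compactin_imp_mtotally_bounded [of "topspace X"] by (simp add: X compact_space_def)
  then have "\<exists>K. finite K \<and> K \<subseteq> topspace X \<and> topspace X \<subseteq> (\<Union>x\<in>K. mball x (inverse (real (Suc n))))" for n
    unfolding mtotally_bounded_def by simp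
  then obtain K where K: "\<And>n. finite (K n)" "\<And>n. K n \<subseteq> topspace X"
      "\<And>n. topspace X \<subseteq> (\<Union>x\<in>K n. mball x (inverse (real (Suc n))))"
    by metis
  show thesis
  proof (rule that [of "\<Union>n. K n"])
    show "countable (\<Union>n. K n)"
      using K(1) by (simp add: countable_finite)
    show "\<exists>q\<in>\<Union>n. K n. d q x < e" if x: "x \<in> topspace X" and "0 < e" for x e
    proof -
      obtain n where n: "inverse (real (Suc n)) < e"
        using reals_Archimedean [OF \<open>0 < e\<close>] by blast
      obtain q where "q \<in> K n" "x \<in> mball q (inverse (real (Suc n)))"
        using K(3) [of n] x by blast
      then show ?thesis
        using n by (intro bexI [of _ q]) auto
    qed
  qed (use K(2) in auto)
qed

text \<open>The coordinates of the embedding are the distances, cut off at 1, from the points of a countable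
  dense set: a point of that set close to \<open>x\<close> has different distances from \<open>x\<close> and from any other
  point \<open>y\<close>. Compactness makes the injection a homeomorphism onto its image.\<close>

lemma compact_metrizable_embeds_in_Hilbert_cube:
  assumes "compact_space X" "metrizable_space X"
  obtains S where "S \<subseteq> topspace Hilbert_cube" "X homeomorphic_space subtopology Hilbert_cube S"
proof (cases "topspace X = {}")
  case True
  then have "X homeomorphic_space subtopology Hilbert_cube {}"
    by (simp add: homeomorphic_empty_space_eq null_topspace_iff_trivial)
  then show thesis
    using that by blast
next
  case False
  obtain d where d: "Metric_space (topspace X) d" and X: "Metric_space.mtopology (topspace X) d = X"
    using \<open>metrizable_space X\<close> unfolding metrizable_space_def
    by (metis Metric_space.topspace_mtopology)
  interpret Metric_space "topspace X" d by (fact d)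
  obtain Q where Q: "countable Q" "Q \<subseteq> topspace X"
      and dense: "\<And>x e. x \<in> topspace X \<Longrightarrow> 0 < e \<Longrightarrow> \<exists>q\<in>Q. d q x < e"
    using compact_metric_countable_dense [OF d X \<open>compact_space X\<close>] by metis
  have "Q \<noteq> {}"
    using False dense [OF _ zero_less_one] by blast
  define q where "q = from_nat_into Q"
  have q: "q i \<in> topspace X" for i
    using from_nat_into [OF \<open>Q \<noteq> {}\<close>] Q(2) unfolding q_def by blast
  define \<phi> where "\<phi> = (\<lambda>x i. min 1 (d (q i) x))"
  have "continuous_map X euclideanreal (d (q i))" for i
    using continuous_on_mdist [of "q i" "metric (topspace X, d)"] q X by simp
  then have cont: "continuous_map X Hilbert_cube \<phi>"
    unfolding continuous_map_Hilbert_cube \<phi>_def by (auto intro!: continuous_map_real_min)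
  have inj: "inj_on \<phi> (topspace X)"
  proof (rule inj_onI, rule ccontr)
    fix x y assume xy: "x \<in> topspace X" "y \<in> topspace X" "\<phi> x = \<phi> y" "x \<noteq> y"
    then have "0 < min 1 (d x y / 2)"
      by simp
    then obtain p where p: "p \<in> Q" "d p x < 1" "d p x < d x y / 2"
      using dense [OF xy(1)] by (metis min_less_iff_conj)
    obtain i where "p = q i"
      using p(1) Q(1) unfolding q_def by (metis from_nat_into_surj)
    then have "d p x = d p y"
      using fun_cong [OF xy(3), of i] p(2) by (simp add: \<phi>_def min_def split: if_splits)
    then show False
      using triangle [of x p y] p xy q \<open>p = q i\<close> by (simp add: commute)
  qed
  have "homeomorphic_map X (subtopology Hilbert_cube (\<phi> ` topspace X)) \<phi>"
    using cont continuous_map_image_subset_topspace [OF cont]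
    by (intro continuous_imp_homeomorphic_map \<open>compact_space X\<close> Hausdorff_space_subtopology
        Hausdorff_space_Hilbert_cube inj) (auto simp: continuous_map_in_subtopology)
  then show thesis
    using that continuous_map_image_subset_topspace [OF cont] homeomorphic_map_imp_homeomorphic_space
    by blast
qed

text \<open>Nearby points \<open>x\<close>, \<open>y\<close> are joined by a path \<open>G (\<cdot>, x, y)\<close> that depends continuously on them and is
  constant for \<open>x = y\<close>: in the Hilbert cube, which is convex, take the segment between them and
  retract it to \<open>X\<close>. The retraction is defined on a neighborhood \<open>U\<close> only; by compactness the
  distance of \<open>x\<close> and \<open>y\<close> has a positive lower bound on the triples \<open>(t, x, y)\<close> for which the point
  at time \<open>t\<close> of the segment is outside \<open>U\<close>, and that bound serves as \<open>\<epsilon>\<close>.\<close>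

lemma compact_ANR_uniformly_locally_equiconnected:
  assumes "compact_ANR X"
    and d: "Metric_space (topspace X) d" and X: "Metric_space.mtopology (topspace X) d = X"
  obtains \<epsilon> G where "0 < \<epsilon>"
    "continuous_map (subtopology (cylinder (prod_topology X X)) {(t, x, y). d x y < \<epsilon>}) X G"
    "\<And>x y. x \<in> topspace X \<Longrightarrow> G (0, x, y) = x"
    "\<And>x y. y \<in> topspace X \<Longrightarrow> G (1, x, y) = y"
    "\<And>t x. x \<in> topspace X \<Longrightarrow> G (t, x, x) = x"
proof -
  interpret Metric_space "topspace X" d by (fact d)
  have "compact_space X" "metrizable_space X"
    using \<open>compact_ANR X\<close> by (auto simp: compact_ANR_def)
  then obtain S where S: "S \<subseteq> topspace Hilbert_cube"
      and hom: "X homeomorphic_space subtopology Hilbert_cube S"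
    by (rule compact_metrizable_embeds_in_Hilbert_cube)
  then obtain U where U: "openin Hilbert_cube U" "S \<subseteq> U"
      and ret: "S retract_of_space subtopology Hilbert_cube U"
    using \<open>compact_ANR X\<close> unfolding compact_ANR_def by metis
  obtain r where r: "continuous_map (subtopology Hilbert_cube U) (subtopology Hilbert_cube S) r"
      and rS: "\<And>x. x \<in> S \<Longrightarrow> r x = x"
    using ret U(2) unfolding retract_of_space_def by (auto simp: subtopology_subtopology Int_absorb1)
  obtain \<phi> \<psi> where \<phi>: "continuous_map X (subtopology Hilbert_cube S) \<phi>"
      and \<psi>: "continuous_map (subtopology Hilbert_cube S) X \<psi>"
      and \<psi>\<phi>: "\<And>x. x \<in> topspace X \<Longrightarrow> \<psi> (\<phi> x) = x"
    using hom unfolding homeomorphic_space_def homeomorphic_maps_def by metis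
  have \<phi>S: "\<phi> x \<in> S" if "x \<in> topspace X" for x
    using \<phi> that by (auto simp: continuous_map_in_subtopology)
  let ?P = "cylinder (prod_topology X X)"
  define mix where "mix = (\<lambda>(t, x, y) i. (1 - t) * \<phi> x i + t * \<phi> y i)"
  have mix: "continuous_map ?P Hilbert_cube mix"
  proof -
    have \<phi>i: "continuous_map X euclideanreal (\<lambda>x. \<phi> x i)"
      and \<phi>01: "x \<in> topspace X \<Longrightarrow> 0 \<le> \<phi> x i \<and> \<phi> x i \<le> 1" for i x
      using continuous_map_into_fulltopology [OF \<phi>] unfolding continuous_map_Hilbert_cube by auto
    have t: "continuous_map ?P euclideanreal fst"
      by (metis continuous_map_fst continuous_map_into_fulltopology)
    have x: "continuous_map ?P euclideanreal (\<lambda>z. \<phi> (fst (snd z)) i)" for i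
      using continuous_map_compose [OF continuous_map_compose [OF continuous_map_snd continuous_map_fst] \<phi>i]
      by (simp add: o_def)
    have y: "continuous_map ?P euclideanreal (\<lambda>z. \<phi> (snd (snd z)) i)" for i
      using continuous_map_compose [OF continuous_map_compose [OF continuous_map_snd continuous_map_snd] \<phi>i]
      by (simp add: o_def)
    show ?thesis
      unfolding continuous_map_Hilbert_cube mix_def case_prod_unfold
      using t x y \<phi>01
      by (auto intro!: continuous_intros convex_bound_le add_nonneg_nonneg mult_nonneg_nonneg)
  qed
  have mix_diag: "mix (t, x, x) = \<phi> x" for t x
    by (simp add: mix_def fun_eq_iff algebra_simps)
  (* The triples for which the segment has left U; none of them has x = y. *)
  define K where "K = topspace ?P - {z \<in> topspace ?P. mix z \<in> U}"
  define \<delta> :: "real \<times> 'a \<times> 'a \<Rightarrow> real" where "\<delta> = (\<lambda>z. d (fst (snd z)) (snd (snd z)))"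
  have \<delta>: "continuous_map ?P euclideanreal \<delta>"
  proof -
    have "continuous_map ?P X (\<lambda>z. fst (snd z))" "continuous_map ?P X (\<lambda>z. snd (snd z))"
      using continuous_map_compose [OF continuous_map_snd continuous_map_fst]
        continuous_map_compose [OF continuous_map_snd continuous_map_snd] by (simp_all add: o_def)
    then show ?thesis
      using continuous_map_mdist [of ?P "metric (topspace X, d)"] unfolding \<delta>_def by (simp add: X)
  qed
  have "closedin ?P K"
    unfolding K_def using openin_continuous_map_preimage [OF mix U(1)] by blast
  moreover have "compact_space ?P"
    using \<open>compact_space X\<close> by (simp add: compact_space_prod_topology compact_space_subtopology)
  ultimately have "compactin ?P K"
    by (simp add: closedin_compact_space)
  then have "compact (\<delta> ` K)"
    using image_compactin [OF _ \<delta>] by simp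
  moreover have "0 \<notin> \<delta> ` K"
  proof
    assume "0 \<in> \<delta> ` K"
    then obtain t x y where "(t, x, y) \<in> K" "d x y = 0"
      unfolding \<delta>_def by force
    then show False
      using mix_diag \<phi>S U(2) by (auto simp: K_def)
  qed
  ultimately obtain \<epsilon> where "0 < \<epsilon>" and \<epsilon>: "\<And>z. z \<in> K \<Longrightarrow> \<epsilon> \<le> \<delta> z"
    using separate_point_closed [of "\<delta> ` K" 0] compact_imp_closed
    by (metis \<delta>_def abs_of_nonneg dist_0_norm imageI nonneg real_norm_def)
  let ?N = "subtopology ?P {(t, x, y). d x y < \<epsilon>}"
  have "continuous_map ?N (subtopology Hilbert_cube U) mix"
    using mix \<epsilon> by (force simp: continuous_map_in_subtopology continuous_map_from_subtopology K_def \<delta>_def)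
  then have "continuous_map ?N X (\<psi> \<circ> (r \<circ> mix))"
    by (intro continuous_map_compose [OF continuous_map_compose [OF _ r] \<psi>])
  moreover have "mix (0, x, y) = \<phi> x" "mix (1, x, y) = \<phi> y" for x y
    by (simp_all add: mix_def)
  ultimately show thesis
    using \<open>0 < \<epsilon>\<close> rS \<phi>S \<psi>\<phi> mix_diag by (intro that [of \<epsilon> "\<psi> \<circ> (r \<circ> mix)"]) auto
qed


section \<open>Small regular cells around Euclidean points\<close>

lemma openin_Euclidean_space_contains_ball:
  assumes W: "openin (Euclidean_space n) W" and p: "p \<in> W"
  obtains \<rho> where "0 < \<rho>" "\<And>y. y \<in> unit_ball n \<Longrightarrow> (\<lambda>i. p i + \<rho> * y i) \<in> W"
proof -
  obtain W' where W': "openin (powertop_real UNIV) W'" and W_eq: "W = W' \<inter> {x. \<forall>i\<ge>n. x i = 0}"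
    using W unfolding Euclidean_space_def openin_subtopology by blast
  obtain B where B: "\<And>i. open (B i)" "p \<in> Pi\<^sub>E UNIV B" "Pi\<^sub>E UNIV B \<subseteq> W'"
    using W' p unfolding W_eq openin_product_topology_alt by simp metis
  have "\<exists>e>0. \<forall>s. \<bar>s - p i\<bar> \<le> e \<longrightarrow> s \<in> B i" for i
  proof -
    have "open (B i)" "p i \<in> B i"
      using B(1,2) by (auto simp: PiE_iff)
    then obtain e where "0 < e" "cball (p i) e \<subseteq> B i"
      using open_contains_cball by blast
    then show ?thesis
      by (intro exI [of _ e]) (auto simp: subset_iff dist_real_def abs_minus_commute)
  qed
  then obtain e where e: "\<And>i. 0 < e i" "\<And>i s. \<bar>s - p i\<bar> \<le> e i \<Longrightarrow> s \<in> B i"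
    by metis
  (* Only the first n coordinates of p vary; the 1 keeps the set nonempty for n = 0. *)
  define \<rho> where "\<rho> = Min (insert 1 (e ` {..<n}))"
  have \<rho>: "0 < \<rho>" "\<And>i. i < n \<Longrightarrow> \<rho> \<le> e i"
    using e(1) by (auto simp: \<rho>_def)
  show thesis
  proof (rule that [OF \<rho>(1)])
    fix y assume y: "y \<in> unit_ball n"
    have y0: "y i = 0" if "i \<ge> n" for i
      using y that by (auto simp: unit_ball_def topspace_Euclidean_space)
    have y1: "\<bar>y i\<bar> \<le> 1" if "i < n" for i
    proof -
      have "(y i)\<^sup>2 \<le> (\<Sum>i<n. (y i)\<^sup>2)"
        using that by (intro member_le_sum) auto
      also have "\<dots> \<le> 1"
        using y by (simp add: unit_ball_def)
      finally show ?thesis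
        by (simp add: abs_square_le_1)
    qed
    have "p i + \<rho> * y i \<in> B i" for i
    proof (cases "i < n")
      case True
      then have "\<rho> * \<bar>y i\<bar> \<le> e i * 1"
        using \<rho> y1 e(1) by (intro mult_mono) (auto intro: less_imp_le)
      then show ?thesis
        using \<rho>(1) by (intro e(2)) (simp add: abs_mult)
    next
      case False
      then show ?thesis
        using B(2) y0 by (simp add: PiE_iff)
    qed
    then show "(\<lambda>i. p i + \<rho> * y i) \<in> W"
      using B(3) p y0 by (auto simp: W_eq PiE_iff)
  qed
qed

lemma homeomorphic_map_Euclidean_space_affine:
  assumes p: "p \<in> topspace (Euclidean_space n)" and "\<rho> \<noteq> 0"
  shows "homeomorphic_map (Euclidean_space n) (Euclidean_space n) (\<lambda>y i. p i + \<rho> * y i)"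
proof -
  have *: "continuous_map (Euclidean_space n) (Euclidean_space n) (\<lambda>y i. a i + b * y i)"
    if "a \<in> topspace (Euclidean_space n)" for a and b :: real
    using that unfolding Euclidean_space_def continuous_map_in_subtopology continuous_map_componentwise_UNIV
    by (auto intro!: continuous_intros continuous_map_from_subtopology continuous_map_product_projection)
  have "continuous_map (Euclidean_space n) (Euclidean_space n) (\<lambda>y i. - p i / \<rho> + (1 / \<rho>) * y i)"
    using p by (intro *) (auto simp: topspace_Euclidean_space)
  then show ?thesis
    using * [OF p, of \<rho>] \<open>\<rho> \<noteq> 0\<close>
    by (intro homeomorphic_maps_imp_map [of _ _ _ "\<lambda>y i. - p i / \<rho> + (1 / \<rho>) * y i"])
      (auto simp: homeomorphic_maps_def fun_eq_iff field_simps)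
qed

lemma n_Euclidean_point_has_small_regular_cell:
  assumes x: "n_Euclidean_point n X x" and W: "openin X W" "x \<in> W"
  obtains C where "regular_n_cell n X C" "C \<subseteq> W"
proof -
  let ?E = "Euclidean_space n"
  obtain U where "1 \<le> n" and U: "openin X U" "x \<in> U" and "subtopology X U homeomorphic_space ?E"
    using x unfolding n_Euclidean_point_def by blast
  then obtain g where g: "homeomorphic_map ?E (subtopology X U) g"
    by (meson homeomorphic_space homeomorphic_space_sym)
  have tU: "topspace (subtopology X U) = U"
    using openin_subset [OF U(1)] by auto
  obtain p where p: "p \<in> topspace ?E" "x = g p"
    using homeomorphic_imp_surjective_map [OF g] U(2) tU by blast
  have "openin ?E {y \<in> topspace ?E. g y \<in> W}"
    using homeomorphic_imp_continuous_map [OF g] W(1)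
    by (intro openin_continuous_map_preimage [where Y = X]) (auto simp: continuous_map_in_subtopology)
  then obtain \<rho> where "0 < \<rho>"
      and \<rho>: "\<And>y. y \<in> unit_ball n \<Longrightarrow> (\<lambda>i. p i + \<rho> * y i) \<in> {y \<in> topspace ?E. g y \<in> W}"
    using openin_Euclidean_space_contains_ball [of n _ p] p W(2) by blast
  define f where "f = g \<circ> (\<lambda>y i. p i + \<rho> * y i)"
  have f: "homeomorphic_map ?E (subtopology X U) f"
    unfolding f_def using \<open>0 < \<rho>\<close>
    by (intro homeomorphic_map_compose [OF homeomorphic_map_Euclidean_space_affine g] p) simp
  define C where "C = f ` unit_ball n"
  have ball: "unit_ball n \<subseteq> topspace ?E"
    by (auto simp: unit_ball_def)
  have "C \<subseteq> U"
    using homeomorphic_imp_surjective_map [OF f] ball tU unfolding C_def by blast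
  have "homeomorphic_map (subtopology ?E (unit_ball n)) (subtopology (subtopology X U) C) f"
    using ball \<open>C \<subseteq> U\<close> tU by (intro homeomorphic_map_subtopologies [OF f]) (auto simp: C_def)
  then have "homeomorphic_map (subtopology ?E (unit_ball n)) (subtopology X C) f"
    using \<open>C \<subseteq> U\<close> by (simp add: subtopology_subtopology Int_absorb1)
  moreover have "openin (subtopology X U) (f ` (unit_ball n - unit_sphere n))"
    using homeomorphic_imp_open_map [OF f] openin_unit_ball_interior by (simp add: open_map_def)
  then have "openin X (f ` (unit_ball n - unit_sphere n))"
    using U(1) openin_trans_full by blast
  moreover have "C \<subseteq> topspace X"
    using \<open>C \<subseteq> U\<close> openin_subset [OF U(1)] by blast
  ultimately have "regular_n_cell n X C"
    using \<open>1 \<le> n\<close> unfolding regular_n_cell_def regular_cell_map_def by blast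
  moreover have "C \<subseteq> W"
    using \<rho> by (auto simp: C_def f_def)
  ultimately show thesis
    by (rule that)
qed

lemma Euclidean_point_open_subspace:
  assumes "openin X V" "Euclidean_point (subtopology X V) x"
  shows "Euclidean_point X x"
proof -
  obtain n U where "1 \<le> n" and U: "openin (subtopology X V) U" "x \<in> U"
      and hom: "subtopology (subtopology X V) U homeomorphic_space Euclidean_space n"
    using assms(2) unfolding Euclidean_point_def n_Euclidean_point_def by blast
  have "U \<subseteq> V"
    using openin_subset [OF U(1)] by auto
  then have "subtopology X U homeomorphic_space Euclidean_space n"
    using hom by (simp add: subtopology_subtopology Int_absorb1)
  then show ?thesis
    unfolding Euclidean_point_def n_Euclidean_point_def
    using \<open>1 \<le> n\<close> U assms(1) openin_trans_full by blast
qed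

lemma almost_Euclidean_pair_has_regular_cell:
  assumes "almost_Euclidean_pair X A" "closedin X A" "openin X V" "V \<inter> A = {}" "V \<noteq> {}"
  obtains n C where "regular_n_cell n X C" "C \<subseteq> V"
proof -
  let ?Y = "subtopology X (topspace X - A)"
  have open_compl: "openin X (topspace X - A)"
    using assms(2) by blast
  have "V \<subseteq> topspace X - A"
    using openin_subset [OF assms(3)] assms(4) by blast
  then have "openin ?Y V"
    using assms(3) by (simp add: openin_open_subtopology open_compl)
  moreover obtain v where "v \<in> V"
    using assms(5) by blast
  then have "v \<in> ?Y closure_of {x. Euclidean_point ?Y x}"
    using assms(1) \<open>V \<subseteq> topspace X - A\<close>
    by (auto simp: almost_Euclidean_pair_def almost_Euclidean_def)
  ultimately obtain x where "x \<in> V" "Euclidean_point ?Y x"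
    using \<open>v \<in> V\<close> unfolding in_closure_of by blast
  then obtain n where "n_Euclidean_point n X x"
    using Euclidean_point_open_subspace [OF open_compl] unfolding Euclidean_point_def by blast
  then show thesis
    using n_Euclidean_point_has_small_regular_cell assms(3) \<open>x \<in> V\<close> that by metis
qed


section \<open>Regular cells missed by a map close to the identity\<close>

text \<open>It suffices that relative cycles bound modulo the complement of the closed cell, which is contained
  in the complement of the open cell.\<close>

lemma not_belongs_to_relative_cycle:
  assumes "regular_n_cell n X C" and A: "A \<subseteq> topspace X - C"
    and triv: "\<And>c :: ('a, circle_group) coeff_chain.
      coeff_relcycle n X A c \<Longrightarrow> coeff_relboundary n X (topspace X - C) c"
  shows "\<not> belongs_to_relative_cycle n X A C"
proof -
  let ?T = "topspace X - open_cell n X C"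
  obtain f where f: "regular_cell_map n X C f"
    using assms(1) unfolding regular_n_cell_def by blast
  then have "f ` unit_ball n = topspace (subtopology X C)"
    using homeomorphic_imp_surjective_map [of "subtopology (Euclidean_space n) (unit_ball n)" "subtopology X C" f]
    by (simp add: regular_cell_map_def unit_ball_def Int_absorb1 subset_iff Int_def)
  then have "open_cell n X C \<subseteq> C"
    unfolding open_cell_eq [OF f] by auto
  then have sub: "topspace X - C \<subseteq> ?T" "A \<subseteq> ?T"
    using A by auto
  have "coeff_inclusion_hom n X ?T K = \<one>\<^bsub>coeff_homology_group n X ?T\<^esub>"
    if K: "K \<in> carrier (coeff_homology_group n X A :: ('a, circle_group) coeff_chain set monoid)" for K
  proof -
    obtain c where c: "coeff_relcycle n X A c"
        and K: "K = Collect (coeff_relboundary n X A) #>\<^bsub>coeff_relcycle_group n X A\<^esub> c"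
      using K unfolding carrier_coeff_homology_group by blast
    have "coeff_relboundary n X ?T c"
      using coeff_relboundary_mono [OF sub(1) triv [OF c]] .
    then have "Collect (coeff_relboundary n X ?T) #>\<^bsub>coeff_relcycle_group n X ?T\<^esub> c = Collect (coeff_relboundary n X ?T)"
      using normal_coeff_relboundary [of n X ?T] comm_group_coeff_relcycle_group [of n X ?T]
      by (metis comm_group.axioms(2) mem_Collect_eq normal_def subgroup.rcos_const)
    then show ?thesis
      unfolding K coeff_inclusion_hom_class [OF sub(2)] by (simp add: coeff_homology_group_def FactGroup_def)
  qed
  then show ?thesis
    unfolding belongs_to_relative_cycle_def by blast
qed

text \<open>Take the \<open>\<epsilon>\<close> of the equiconnecting map \<open>G\<close>. If \<open>f\<close> is \<open>\<epsilon>\<close>-close to the identity, then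
  \<open>G (t, f x, x)\<close> is a homotopy from \<open>f\<close> to the identity that is stationary at the fixed points of \<open>f\<close>,
  in particular on \<open>A\<close>. If \<open>f\<close> misses a point, it misses a whole regular cell, and that cell belongs to no relative
  cycle.\<close>

theorem theorem4p4:
  fixes X :: "'a topology" and A :: "'a set" and d :: "'a \<Rightarrow> 'a \<Rightarrow> real"
  assumes "compact_pair X A"
    and "almost_Euclidean_pair X A"
    and "compact_ANR X"
    and "Metric_space (topspace X) d"
    and "Metric_space.mtopology (topspace X) d = X"
    and "\<And>n C. regular_n_cell n X C \<Longrightarrow> C \<subseteq> topspace X - A \<Longrightarrow> belongs_to_relative_cycle n X A C"
  shows "\<exists>\<epsilon>>0. eps_surjection_property X A d \<epsilon>"
proof -
  have "compact_space X" "Hausdorff_space X" "compactin X A"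
    using assms(1) metrizable_imp_Hausdorff_space by (auto simp: compact_pair_def)
  then have "closedin X A" "A \<subseteq> topspace X"
    by (simp_all add: compactin_imp_closedin compactin_subset_topspace)
  obtain \<epsilon> G where "0 < \<epsilon>"
      and G: "continuous_map (subtopology (cylinder (prod_topology X X)) {(t, x, y). d x y < \<epsilon>}) X G"
      and G_start: "\<And>x y. x \<in> topspace X \<Longrightarrow> G (0, x, y) = x"
      and G_end: "\<And>x y. y \<in> topspace X \<Longrightarrow> G (1, x, y) = y"
      and G_diag: "\<And>t x. x \<in> topspace X \<Longrightarrow> G (t, x, x) = x"
    using compact_ANR_uniformly_locally_equiconnected [OF assms(3-5)] by blast
  have "f ` topspace X = topspace X"
    if f: "continuous_map X X f" and fA: "\<forall>a\<in>A. f a = a" and close: "\<forall>x\<in>topspace X. d (f x) x < \<epsilon>" for f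
  proof (rule ccontr)
    assume "f ` topspace X \<noteq> topspace X"
    define V where "V = topspace X - f ` topspace X"
    have f_in: "f x \<in> topspace X" if "x \<in> topspace X" for x
      using continuous_map_image_subset_topspace [OF f] that by blast
    have "V \<noteq> {}"
      using f_in \<open>f ` topspace X \<noteq> topspace X\<close> by (auto simp: V_def)
    have "closedin X (f ` topspace X)"
      using \<open>compact_space X\<close> image_compactin [OF _ f] \<open>Hausdorff_space X\<close>
      by (simp add: compact_space_def compactin_imp_closedin)
    then have "openin X V"
      unfolding V_def by blast
    have "A \<subseteq> f ` topspace X"
      using fA \<open>A \<subseteq> topspace X\<close> by (metis image_eqI subset_iff)
    then have "V \<inter> A = {}"
      by (auto simp: V_def)
    then obtain n C where C: "regular_n_cell n X C" "C \<subseteq> V"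
      using almost_Euclidean_pair_has_regular_cell [OF assms(2) \<open>closedin X A\<close> \<open>openin X V\<close> _ \<open>V \<noteq> {}\<close>]
      by metis
    have A_sub: "A \<subseteq> topspace X - C"
      using C(2) \<open>V \<inter> A = {}\<close> \<open>A \<subseteq> topspace X\<close> by blast
    define h where "h = (\<lambda>(t, x). G (t, f x, x))"
    have h: "continuous_map (cylinder X) X h"
    proof -
      have "continuous_map (cylinder X) (cylinder (prod_topology X X)) (\<lambda>(t, x). (t, f x, x))"
        using continuous_map_compose [OF continuous_map_snd f]
        by (auto simp: case_prod_unfold continuous_map_pairwise o_def continuous_map_fst continuous_map_snd)
      then have "continuous_map (cylinder X)
          (subtopology (cylinder (prod_topology X X)) {(t, x, y). d x y < \<epsilon>}) (\<lambda>(t, x). (t, f x, x))"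
        using close by (auto simp: continuous_map_in_subtopology)
      from continuous_map_compose [OF this G] show ?thesis
        by (simp add: h_def o_def case_prod_unfold)
    qed
    have "coeff_relboundary n X (topspace X - C) c"
      if "coeff_relcycle n X A c" for c :: "('a, circle_group) coeff_chain"
    proof (rule coeff_relcycle_imp_relboundary_homotopy [OF h _ _ _ A_sub that])
      show "h (0, x) \<in> topspace X - C" if "x \<in> topspace X" for x
        using that C(2) f_in by (auto simp: h_def G_start V_def)
      show "h (1, x) = x" if "x \<in> topspace X" for x
        using that by (simp add: h_def G_end)
      show "h (t, x) \<in> A" if "x \<in> A" for t x
        using that fA \<open>A \<subseteq> topspace X\<close> by (auto simp: h_def G_diag)
    qed
    then have "\<not> belongs_to_relative_cycle n X A C"
      by (rule not_belongs_to_relative_cycle [OF C(1) A_sub])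
    then show False
      using assms(6) [OF C(1)] C(2) \<open>V \<inter> A = {}\<close> by (auto simp: V_def)
  qed
  then show ?thesis
    using \<open>0 < \<epsilon>\<close> unfolding eps_surjection_property_def by blast
qed

end
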